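(* Let $G$ be a uniformly Borel amenable Følner graph on a standard Borel space $X$. Then for every $\epsilon_0>0$ there exist $k>0$, $\rho>0$ and an $(\epsilon_0,k)$-Følner Borel packing $\mathcal{T}$ of $G$ such that for every finite $\rho$-Følner subset $J\subseteq X$ we have $\frac{|J_{\mathcal{T}}|}{|J|}\ge 1-\epsilon_0$.
   Context: A Borel graph on $X$ is a symmetric loopless Borel $G\subseteq X\times X$; $d_G$ is the graph distance and $\mathcal{E}_G$ the connected-component equivalence relation. Uniformly Borel amenable: $G$ has bounded degree and for every $n\ge1$ there is a non-negative Borel $p_n:\mathcal{E}_G\to\mathbb{R}$ with (1) $\sum_{y\,\mathcal{E}_G\,x}p_n(x,y)=1$ for all $x$; (2) if $x\sim_G z$ then $\sum_{y}|p_n(x,y)-p_n(z,y)|<1/n$; (3) there is $r_n>0$ with $p_n(x,y)=0$ whenever $d_G(x,y)>r_n$. For finite $L\subseteq X$, $\partial L$ is the set of $x\in L$ with a neighbour outside $L$; $L$ is $\epsilon$-Følner if $|\partial L|/|L|<\epsilon$, and $(\epsilon,k)$-Følner if moreover its $G$-diameter is at most $k$. $G$ is Følner if for every $\epsilon>0$ there is $r>0$ such that every ball $B_r(x)$ contains an $\epsilon$-Følner set. Borel packing: a Borel subequivalence relation of the restriction of $\mathcal{E}_G$ to a Borel set $X'\subseteq X$ whose classes (tiles) have uniformly bounded $G$-diameter. A packing is $(\epsilon,k)$-Følner if all its tiles are $(\epsilon,k)$-Følner. For a packing $\mathcal{T}$ and finite $J$, $J_{\mathcal{T}}$ is the union of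 those tiles of $\mathcal{T}$ that are contained in $J$. *)

theory Defs
  imports "HOL-Analysis.Analysis"
begin

text \<open>The standard Borel space X is modelled as a type of class polish_space with its
Borel sigma-algebra; Borel subsets of X x X are the sets of the product sigma-algebra
(which coincides with the Borel sigma-algebra of X x X for Polish X).\<close>

definition borel_graph :: "('a::polish_space \<times> 'a) set \<Rightarrow> bool" where
  "borel_graph G \<longleftrightarrow> sym G \<and> irrefl G \<and> G \<in> sets (borel \<Otimes>\<^sub>M borel)"

definition gdist_le :: "('a \<times> 'a) set \<Rightarrow> 'a \<Rightarrow> 'a \<Rightarrow> real \<Rightarrow> bool" where
  "gdist_le G x y r \<longleftrightarrow> (\<exists>n::nat. real n \<le> r \<and> (x, y) \<in> (G \<union> Id) ^^ n)"

definition gball :: "('a \<times> 'a) set \<Rightarrow> 'a \<Rightarrow> real \<Rightarrow> 'a set" where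
  "gball G x r = {y. gdist_le G x y r}"

definition comp_rel :: "('a \<times> 'a) set \<Rightarrow> ('a \<times> 'a) set" where
  "comp_rel G = G\<^sup>*"

definition bounded_degree :: "('a \<times> 'a) set \<Rightarrow> bool" where
  "bounded_degree G \<longleftrightarrow> (\<exists>D::nat. \<forall>x. finite (G `` {x}) \<and> card (G `` {x}) \<le> D)"

definition unif_borel_amenable :: "('a::polish_space \<times> 'a) set \<Rightarrow> bool" where
  "unif_borel_amenable G \<longleftrightarrow> bounded_degree G \<and>
     (\<forall>n::nat. n \<ge> 1 \<longrightarrow> (\<exists>p :: 'a \<times> 'a \<Rightarrow> real.
        p \<in> borel_measurable (restrict_space (borel \<Otimes>\<^sub>M borel) (comp_rel G)) \<and>
        (\<forall>xy\<in>comp_rel G. p xy \<ge> 0) \<and>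
        (\<forall>x. (\<Sum>\<^sub>\<infinity>y\<in>comp_rel G `` {x}. p (x, y)) = 1) \<and>
        (\<forall>x z. (x, z) \<in> G \<longrightarrow>
           (\<Sum>\<^sub>\<infinity>y\<in>comp_rel G `` {x}. \<bar>p (x, y) - p (z, y)\<bar>) < 1 / real n) \<and>
        (\<exists>r>0. \<forall>x y. (x, y) \<in> comp_rel G \<and> \<not> gdist_le G x y r \<longrightarrow> p (x, y) = 0)))"

definition gboundary :: "('a \<times> 'a) set \<Rightarrow> 'a set \<Rightarrow> 'a set" where
  "gboundary G L = {x\<in>L. \<exists>y. (x, y) \<in> G \<and> y \<notin> L}"

definition folner_set :: "('a \<times> 'a) set \<Rightarrow> real \<Rightarrow> 'a set \<Rightarrow> bool" where
  "folner_set G \<epsilon> L \<longleftrightarrow> finite L \<and> L \<noteq> {} \<and>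
     real (card (gboundary G L)) / real (card L) < \<epsilon>"

definition folner_diam_set :: "('a \<times> 'a) set \<Rightarrow> real \<Rightarrow> real \<Rightarrow> 'a set \<Rightarrow> bool" where
  "folner_diam_set G \<epsilon> k L \<longleftrightarrow> folner_set G \<epsilon> L \<and> (\<forall>x\<in>L. \<forall>y\<in>L. gdist_le G x y k)"

definition folner_graph :: "('a \<times> 'a) set \<Rightarrow> bool" where
  "folner_graph G \<longleftrightarrow> (\<forall>\<epsilon>>0. \<exists>r>0. \<forall>x. \<exists>L. L \<subseteq> gball G x r \<and> folner_set G \<epsilon> L)"

definition borel_packing :: "('a::polish_space \<times> 'a) set \<Rightarrow> 'a set \<Rightarrow> ('a \<times> 'a) set \<Rightarrow> bool" where
  "borel_packing G X' T \<longleftrightarrow> X' \<in> sets borel \<and> T \<in> sets (borel \<Otimes>\<^sub>M borel) \<and>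
     equiv X' T \<and> T \<subseteq> comp_rel G \<and>
     (\<exists>B. \<forall>x\<in>X'. \<forall>y\<in>T `` {x}. \<forall>z\<in>T `` {x}. gdist_le G y z B)"

definition tiles :: "'a set \<Rightarrow> ('a \<times> 'a) set \<Rightarrow> 'a set set" where
  "tiles X' T = X' // T"

definition folner_packing :: "('a::polish_space \<times> 'a) set \<Rightarrow> real \<Rightarrow> real \<Rightarrow> 'a set \<Rightarrow> ('a \<times> 'a) set \<Rightarrow> bool" where
  "folner_packing G \<epsilon> k X' T \<longleftrightarrow> borel_packing G X' T \<and>
     (\<forall>S\<in>tiles X' T. folner_diam_set G \<epsilon> k S)"

definition packed_part :: "'a set \<Rightarrow> ('a \<times> 'a) set \<Rightarrow> 'a set \<Rightarrow> 'a set" where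
  "packed_part X' T J = \<Union>{S\<in>tiles X' T. S \<subseteq> J}"

end

theory Submission
  imports Defs
begin

text \<open>Viewed in its second variable, the kernel p of uniform amenability is a fractional tiling: for
  fixed y the superlevel sets of p(_, y) are finite sets of bounded diameter, by the layer-cake formula
  they cover every point with total weight 1, and the small variation of p makes most of them Folner.
  Double counting therefore shows that a Borel family of Folner sets which is maximal with respect to
  overlapping at most a proportion \<epsilon> of earlier members fills a definite proportion of every very
  Folner set J. As in the Ornstein-Weiss quasi-tiling argument, this is iterated from large to
  small scales: after a stage with sufficiently Folner tiles the uncovered part of J is still
  Folner for the next smaller scale unless it is already negligible, so it shrinks geometrically.

  The maximal families are Borel because they are built from finitely many Borel colour classes;
  this uses that neighbourhoods of Borel sets are Borel, i.e. the bounded case of the Lusin-Novikov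
  theorem, which is derived from Lusin separation.\<close>

section \<open>Projections of Borel sets\<close>

text \<open>Tiles must be disjoint, so a tile is only the remnant of a Folner set \<open>S\<close>
  after its overlap with earlier members is removed, and the bound on its boundary ratio contains
  \<open>D * \<epsilon>\<close> with a fixed \<epsilon>. That suffices for the final packing but is
  too weak for passing to the next stage. Each tile therefore keeps its \<open>S\<close>, which lies
  in the covered set \<open>V\<close>: the boundary of the uncovered part of J is charged to the
  boundaries of these \<open>S\<close>, whose ratio \<delta> may be as small as desired. Hence
  \<epsilon> depends only on \<open>D\<close> and the target \<gamma>, while \<delta> changes from
  stage to stage. The induction runs against the order of placement. A new stage is put in front of
  a scheme that already works, because its \<delta> must be small compared with the tolerance of all
  later stages; so the scheme has to work off an arbitrary Borel set, such as the one just covered.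
  The Borel obstacle is to select sets without selecting points: colours leave finitely many codes,
  and sets with one code and one centre colour are told apart by a countable base.\<close>

instance prod :: (polish_space, polish_space) polish_space ..

text \<open>These are the analytic (Suslin) sets. The parameter space is a sequence space, so that
  countably many parameters can be coded by a single one.\<close>

definition closed_proj :: "'z::polish_space set \<Rightarrow> bool" where
  "closed_proj B \<longleftrightarrow> (\<exists>C :: ('z \<times> (nat \<Rightarrow> real)) set. closed C \<and> B = fst ` C)"

lemma closed_proj_closed:
  assumes "closed B" shows "closed_proj B"
  unfolding closed_proj_def
  by (rule exI[of _ "B \<times> UNIV"]) (use assms in \<open>auto intro: closed_Times\<close>)

lemma continuous_on_snd_coordinate:
  "continuous_on UNIV (\<lambda>p :: 'a::topological_space \<times> ('i \<Rightarrow> 'b::topological_space). snd p i)"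
  using continuous_on_compose2[OF continuous_on_product_coordinates, of UNIV snd i]
  by (simp add: continuous_on_snd)

text \<open>Coordinate 0 of the parameter stores the index; the gap 1/2 keeps the coded union closed.\<close>

lemma closed_proj_UN:
  assumes "\<And>n::nat. closed_proj (B n)"
  shows "closed_proj (\<Union>n. B n)"
proof -
  obtain C :: "nat \<Rightarrow> ('a \<times> (nat \<Rightarrow> real)) set"
    where C: "\<And>n. closed (C n)" "\<And>n. B n = fst ` C n"
    using assms unfolding closed_proj_def by metis
  define sh where "sh p = (fst p, \<lambda>i. snd p (Suc i))" for p :: "'a \<times> (nat \<Rightarrow> real)"
  have sh: "continuous_on UNIV sh"
    unfolding sh_def
    by (intro continuous_on_Pair continuous_on_fst continuous_on_id continuous_on_coordinatewise_then_product
        continuous_on_snd_coordinate)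
  have c0: "continuous_on UNIV (\<lambda>p :: 'a \<times> (nat \<Rightarrow> real). snd p 0)"
    by (rule continuous_on_snd_coordinate)
  define D where "D = {p. snd p 0 \<in> \<int>} \<inter> {p. snd p 0 \<ge> 0} \<inter>
     (\<Inter>n. {p :: 'a \<times> (nat \<Rightarrow> real). \<bar>snd p 0 - real n\<bar> \<ge> 1/2} \<union> (sh -` C n))"
  have D: "p \<in> D \<longleftrightarrow> (\<exists>n. snd p 0 = real n \<and> sh p \<in> C n)" for p
  proof
    assume p: "p \<in> D"
    then obtain n where n: "snd p 0 = real n" unfolding D_def
      by (auto elim!: Ints_cases) (metis of_nat_nat)
    moreover have "\<bar>snd p 0 - real n\<bar> \<ge> 1/2 \<or> sh p \<in> C n"
      using p unfolding D_def by blast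
    ultimately show "\<exists>n. snd p 0 = real n \<and> sh p \<in> C n" by auto
  next
    assume "\<exists>n. snd p 0 = real n \<and> sh p \<in> C n"
    then obtain n where n: "snd p 0 = real n" "sh p \<in> C n" by auto
    have "\<bar>snd p 0 - real m\<bar> \<ge> 1/2 \<or> sh p \<in> C m" for m
      using n by (cases "m = n"; cases "m < n") auto
    then show "p \<in> D" unfolding D_def using n(1) by auto
  qed
  have "closed D"
    unfolding D_def
  proof (intro closed_Int closed_INT ballI closed_Un)
    show "closed {p :: 'a \<times> (nat \<Rightarrow> real). snd p 0 \<in> \<int>}"
      using closed_vimage[OF closed_Ints c0] by (simp add: vimage_def)
    show "closed {p :: 'a \<times> (nat \<Rightarrow> real). snd p 0 \<ge> 0}"
      by (intro closed_Collect_le continuous_intros c0)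
    show "closed {p :: 'a \<times> (nat \<Rightarrow> real). \<bar>snd p 0 - real n\<bar> \<ge> 1/2}" for n
      by (intro closed_Collect_le continuous_intros c0)
    show "closed (sh -` C n)" for n
      by (rule closed_vimage[OF C(1) sh])
  qed
  moreover have "(\<Union>n. B n) = fst ` D"
  proof (intro equalityI subsetI)
    fix z assume "z \<in> (\<Union>n. B n)"
    then obtain n f where nf: "(z, f) \<in> C n" using C(2) by auto
    have "(z, case_nat (real n) f) \<in> D"
      unfolding D sh_def using nf by auto
    then show "z \<in> fst ` D" by force
  next
    fix z assume "z \<in> fst ` D"
    then obtain p n where "z = fst p" "sh p \<in> C n" using D by auto
    then have "z \<in> B n" using imageI[of "sh p" "C n" fst] by (simp add: C(2) sh_def)
    then show "z \<in> (\<Union>n. B n)" by blast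
  qed
  ultimately show ?thesis unfolding closed_proj_def by blast
qed

text \<open>A point of the intersection has one witness for every \<open>n\<close>;
  \<open>prod_encode\<close> interleaves all of them into one sequence, on which every single
  constraint is closed.\<close>

lemma closed_proj_INT:
  assumes "\<And>n::nat. closed_proj (B n)"
  shows "closed_proj (\<Inter>n. B n)"
proof -
  obtain C :: "nat \<Rightarrow> ('a \<times> (nat \<Rightarrow> real)) set"
    where C: "\<And>n. closed (C n)" "\<And>n. B n = fst ` C n"
    using assms unfolding closed_proj_def by metis
  define sh where "sh n p = (fst p, \<lambda>i. snd p (prod_encode (n, i)))" for n and p :: "'a \<times> (nat \<Rightarrow> real)"
  have sh: "continuous_on UNIV (sh n)" for n
    unfolding sh_def
    by (intro continuous_on_Pair continuous_on_fst continuous_on_id continuous_on_coordinatewise_then_product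
        continuous_on_snd_coordinate)
  have "closed (\<Inter>n. sh n -` C n)"
    by (intro closed_INT ballI closed_vimage C sh)
  moreover have "(\<Inter>n. B n) = fst ` (\<Inter>n. sh n -` C n)"
  proof (intro equalityI subsetI)
    fix z assume "z \<in> (\<Inter>n. B n)"
    then have "\<forall>n. \<exists>f. (z, f) \<in> C n" using C(2) by force
    then obtain f where f: "\<And>n. (z, f n) \<in> C n" by metis
    have "(z, \<lambda>m. case prod_decode m of (n, i) \<Rightarrow> f n i) \<in> (\<Inter>n. sh n -` C n)"
      using f by (auto simp: sh_def)
    then show "z \<in> fst ` (\<Inter>n. sh n -` C n)" by force
  next
    fix z assume "z \<in> fst ` (\<Inter>n. sh n -` C n)"
    then obtain p where p: "z = fst p" "\<And>n. sh n p \<in> C n" by auto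
    have "z \<in> B n" for n using p(2)[of n] p(1) imageI[of "sh n p" "C n" fst] by (simp add: C(2) sh_def)
    then show "z \<in> (\<Inter>n. B n)" by blast
  qed
  ultimately show ?thesis unfolding closed_proj_def by blast
qed

lemma closed_proj_open:
  fixes U :: "'z::polish_space set"
  assumes "open U" shows "closed_proj U"
proof (cases "U = UNIV")
  case True then show ?thesis by (simp add: closed_proj_closed)
next
  \<comment> \<open>\<open>infdist\<close> to the empty set is 0, so the description of
    \<open>U\<close> below would fail for \<open>U = UNIV\<close>.\<close>
  case False
  have "U = (\<Union>n. {z. infdist z (-U) \<ge> 1 / Suc n})"
  proof (intro equalityI subsetI)
    fix z assume "z \<in> U"
    then have "infdist z (-U) > 0"
      using False assms by (intro infdist_pos_not_in_closed) auto
    then obtain n where "1 / Suc n < infdist z (-U)" by (rule nat_approx_posE)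
    then show "z \<in> (\<Union>n. {z. infdist z (-U) \<ge> 1 / Suc n})" by (auto intro!: exI[of _ n])
  next
    fix z assume "z \<in> (\<Union>n. {z. infdist z (-U) \<ge> 1 / Suc n})"
    then obtain n where "infdist z (-U) \<ge> 1 / Suc n" by auto
    moreover have "1 / real (Suc n) > 0" by simp
    ultimately have "infdist z (-U) > 0" by linarith
    then show "z \<in> U" using infdist_zero[of z "-U"] by (cases "z \<in> U") auto
  qed
  moreover have "closed_proj {z. infdist z (-U) \<ge> 1 / Suc n}" for n
    by (intro closed_proj_closed closed_Collect_le continuous_intros)
  ultimately show ?thesis using closed_proj_UN[of "\<lambda>n. {z. infdist z (-U) \<ge> 1 / Suc n}"] by simp
qed

text \<open>Analytic sets are not stable under complements, so the induction carries
  \<open>B\<close> and \<open>-B\<close> together: a complement swaps the two, and a union needs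
  unions for one and intersections for the other.\<close>

lemma closed_proj_borel:
  fixes B :: "'z::polish_space set"
  assumes "B \<in> sets borel" shows "closed_proj B"
proof -
  have "B \<in> sigma_sets UNIV {S. open S}" using assms by (simp add: sets_borel)
  then have "closed_proj B \<and> closed_proj (-B)"
  proof induction
    case (Basic a) then show ?case by (auto intro: closed_proj_open closed_proj_closed)
  next
    case Empty then show ?case by (auto intro: closed_proj_closed)
  next
    case (Compl a) then show ?case by (simp add: Compl_eq_Diff_UNIV[symmetric])
  next
    case (Union a)
    have "- (\<Union>i. a i) = (\<Inter>i. - a i)" by auto
    with Union show ?case by (auto intro: closed_proj_UN closed_proj_INT)
  qed
  then show ?thesis ..
qed

section \<open>Separation of analytic sets by Borel sets\<close>

definition borel_sep :: "'x::topological_space set \<Rightarrow> 'x set \<Rightarrow> bool" where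
  "borel_sep A B \<longleftrightarrow> (\<exists>S\<in>sets borel. A \<subseteq> S \<and> S \<inter> B = {})"

text \<open>If \<open>S i j\<close> separates the pieces, the union over i of the intersections over
  j separates the whole. It is used contrapositively: a non-separable pair has a non-separable pair
  of pieces in any countable cover.\<close>

lemma borel_sep_UN:
  assumes "A \<subseteq> (\<Union>i::nat. A' i)" "B \<subseteq> (\<Union>j::nat. B' j)" "\<And>i j. borel_sep (A' i) (B' j)"
  shows "borel_sep A B"
proof -
  obtain S where S: "\<And>i j. S i j \<in> sets borel" "\<And>i j. A' i \<subseteq> S i j" "\<And>i j. S i j \<inter> B' j = {}"
    using assms(3) unfolding borel_sep_def by metis
  have "(\<Union>i. \<Inter>j. S i j) \<in> sets borel" using S(1) by auto
  moreover have "A \<subseteq> (\<Union>i. \<Inter>j. S i j)"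
  proof
    fix x assume "x \<in> A"
    then obtain i where "x \<in> A' i" using assms(1) by blast
    then have "x \<in> S i j" for j using S(2)[of i j] by blast
    then show "x \<in> (\<Union>i. \<Inter>j. S i j)" by blast
  qed
  moreover have "(\<Union>i. \<Inter>j. S i j) \<inter> B = {}"
  proof (rule equals0I)
    fix x assume x: "x \<in> (\<Union>i. \<Inter>j. S i j) \<inter> B"
    then obtain i where i: "\<And>j. x \<in> S i j" by blast
    obtain j where "x \<in> B' j" using x assms(2) by blast
    then show False using S(3)[of i j] i[of j] by blast
  qed
  ultimately show ?thesis unfolding borel_sep_def by blast
qed

lemma countable_cball_cover:
  fixes e :: real assumes "e > 0"
  obtains d :: "nat \<Rightarrow> 'p::{metric_space, second_countable_topology}" where "(\<Union>i. cball (d i) e) = UNIV"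
proof -
  obtain Dn :: "'p set" where Dn: "countable Dn" "\<And>X. open X \<Longrightarrow> X \<noteq> {} \<Longrightarrow> \<exists>d\<in>Dn. d \<in> X"
    using countable_dense_setE by metis
  have ne: "Dn \<noteq> {}" using Dn(2)[of UNIV] by auto
  have "x \<in> (\<Union>i. cball (from_nat_into Dn i) e)" for x
  proof -
    obtain d where d: "d \<in> Dn" "d \<in> ball x e" using Dn(2)[of "ball x e"] assms by auto
    then obtain i where "d = from_nat_into Dn i" using Dn(1) from_nat_into_surj by metis
    then show ?thesis using d by (auto simp: dist_commute intro!: exI[of _ i] less_imp_le)
  qed
  then show ?thesis using that by blast
qed

text \<open>Lusin separation: a non-separable pair of closed sets shrinks, staying non-separable, to a
  pair of points, whose images are separated by open sets.\<close>

lemma lusin_separation: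
  fixes f :: "'p::polish_space \<Rightarrow> 'x::t2_space"
  assumes cl: "closed C" "closed C'" and f: "continuous_on UNIV f" and disj: "f ` C \<inter> f ` C' = {}"
  shows "borel_sep (f ` C) (f ` C')"
proof (rule ccontr)
  assume nsep: "\<not> borel_sep (f ` C) (f ` C')"
  define P where "P n q \<longleftrightarrow> closed (fst q) \<and> closed (snd q) \<and> fst q \<subseteq> C \<and> snd q \<subseteq> C' \<and>
     \<not> borel_sep (f ` fst q) (f ` snd q)" for n :: nat and q :: "'p set \<times> 'p set"
  define Q where "Q n q q' \<longleftrightarrow> fst q' \<subseteq> fst q \<and> snd q' \<subseteq> snd q \<and>
     (\<exists>a. fst q' \<subseteq> cball a (1 / Suc n)) \<and> (\<exists>a. snd q' \<subseteq> cball a (1 / Suc n))"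
     for n :: nat and q q' :: "'p set \<times> 'p set"
  have "\<exists>q. \<forall>n. P n (q n) \<and> Q n (q n) (q (Suc n))"
  proof (rule dependent_nat_choice)
    show "\<exists>q. P 0 q" using nsep cl by (intro exI[of _ "(C, C')"]) (auto simp: P_def)
  next
    fix q n assume q: "P n q"
    obtain d :: "nat \<Rightarrow> 'p" where d: "(\<Union>i. cball (d i) (1 / Suc n)) = UNIV"
      using countable_cball_cover[of "1 / Suc n"] by auto
    have "\<exists>i j. \<not> borel_sep (f ` (fst q \<inter> cball (d i) (1 / Suc n))) (f ` (snd q \<inter> cball (d j) (1 / Suc n)))"
    proof (rule ccontr)
      assume *: "\<not> ?thesis"
      have cov: "f ` E \<subseteq> (\<Union>i. f ` (E \<inter> cball (d i) (1 / Suc n)))" for E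
        using d by blast
      have "borel_sep (f ` fst q) (f ` snd q)"
        by (rule borel_sep_UN[OF cov cov]) (use * in blast)
      then show False using q by (simp add: P_def)
    qed
    then obtain i j where ij: "\<not> borel_sep (f ` (fst q \<inter> cball (d i) (1 / Suc n))) (f ` (snd q \<inter> cball (d j) (1 / Suc n)))"
      by blast
    let ?q = "(fst q \<inter> cball (d i) (1 / Suc n), snd q \<inter> cball (d j) (1 / Suc n))"
    have "P (Suc n) ?q" using q ij by (auto simp: P_def)
    moreover have "Q n q ?q" unfolding Q_def by auto
    ultimately show "\<exists>q'. P (Suc n) q' \<and> Q n q q'" by blast
  qed
  then obtain q where q: "\<And>n. P n (q n)" "\<And>n. Q n (q n) (q (Suc n))" by blast
  \<comment> \<open>Cantor's intersection theorem for shrinking closed sets, recording also that the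
    sets enter every ball around the common point.\<close>
  have key: "\<exists>a. (\<forall>n. a \<in> E n) \<and> (\<forall>e>0. \<exists>n. E n \<subseteq> ball a e)"
    if E: "\<And>n. closed (E n)" "\<And>n. E n \<noteq> {}" "\<And>n. E (Suc n) \<subseteq> E n" "\<And>n. \<exists>a. E (Suc n) \<subseteq> cball a (1 / Suc n)"
    for E :: "nat \<Rightarrow> 'p set"
  proof -
    have small: "\<exists>n. \<forall>x\<in>E n. \<forall>y\<in>E n. dist x y < e" if "e > 0" for e
    proof -
      have "0 < e/2" using that by simp
      then obtain n where n: "1 / Suc n < e/2" by (rule nat_approx_posE)
      obtain a where a: "E (Suc n) \<subseteq> cball a (1 / Suc n)" using E(4) by blast
      have "dist x y < e" if "x \<in> E (Suc n)" "y \<in> E (Suc n)" for x y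
      proof -
        have "dist a x \<le> 1 / Suc n" "dist a y \<le> 1 / Suc n" using a that by auto
        then show ?thesis using dist_triangle3[of x y a] n by linarith
      qed
      then show ?thesis by blast
    qed
    have "E n \<subseteq> E m" if "m \<le> n" for m n
      using decseqD[OF decseq_SucI[of E, OF E(3)] that] .
    then obtain a where a: "\<And>n. a \<in> E n"
      using decreasing_closed_nest[of E, OF E(1,2) _ small] by blast
    have "\<exists>n. E n \<subseteq> ball a e" if "e > 0" for e
      using small[OF that] a by (meson mem_ball subsetI)
    with a show ?thesis by blast
  qed
  have ne: "fst (q n) \<noteq> {}" "snd (q n) \<noteq> {}" for n
    using q(1)[of n] unfolding P_def borel_sep_def by (auto intro: bexI[of _ "{}"] bexI[of _ UNIV])
  obtain a where a: "\<And>n. a \<in> fst (q n)" "\<And>e. e > 0 \<Longrightarrow> \<exists>n. fst (q n) \<subseteq> ball a e"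
    using key[of "\<lambda>n. fst (q n)"] q ne unfolding P_def Q_def by blast
  obtain b where b: "\<And>n. b \<in> snd (q n)" "\<And>e. e > 0 \<Longrightarrow> \<exists>n. snd (q n) \<subseteq> ball b e"
    using key[of "\<lambda>n. snd (q n)"] q ne unfolding P_def Q_def by blast
  have "a \<in> C" "b \<in> C'" using a(1)[of 0] b(1)[of 0] q(1)[of 0] unfolding P_def by auto
  then have "f a \<noteq> f b" using disj by blast
  then obtain U V where UV: "open U" "open V" "f a \<in> U" "f b \<in> V" "U \<inter> V = {}"
    using hausdorff[of "f a" "f b"] by auto
  obtain e1 where e1: "e1 > 0" "ball a e1 \<subseteq> f -` U"
    using open_vimage[OF UV(1) f] UV(3) by (meson openE vimageI2)
  obtain e2 where e2: "e2 > 0" "ball b e2 \<subseteq> f -` V"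
    using open_vimage[OF UV(2) f] UV(4) by (meson openE vimageI2)
  obtain n1 n2 where n: "fst (q n1) \<subseteq> ball a e1" "snd (q n2) \<subseteq> ball b e2"
    using a(2)[OF e1(1)] b(2)[OF e2(1)] by blast
  define n where "n = max n1 n2"
  have "decseq (\<lambda>n. fst (q n))" "decseq (\<lambda>n. snd (q n))"
    by (rule decseq_SucI, use q(2) in \<open>unfold Q_def, blast\<close>)+
  then have "fst (q n) \<subseteq> fst (q n1)" "snd (q n) \<subseteq> snd (q n2)"
    unfolding n_def decseq_def by simp_all
  then have "f ` fst (q n) \<subseteq> U" "f ` snd (q n) \<subseteq> V" using n e1 e2 by blast+
  then have "borel_sep (f ` fst (q n)) (f ` snd (q n))"
    unfolding borel_sep_def using UV by (intro bexI[of _ U]) (auto intro: borel_open)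
  then show False using q(1)[of n] by (simp add: P_def)
qed

text \<open>A Borel set of the product is itself the projection of a closed set, so its first
  projection is the image of a closed set under the continuous map \<open>fst (fst p)\<close>, and
  Lusin separation applies.\<close>

lemma borel_sep_fst_image:
  fixes F F' :: "('x::polish_space \<times> 'w::polish_space) set"
  assumes "F \<in> sets borel" "F' \<in> sets borel" "fst ` F \<inter> fst ` F' = {}"
  shows "borel_sep (fst ` F) (fst ` F')"
proof -
  obtain C C' :: "(('x \<times> 'w) \<times> (nat \<Rightarrow> real)) set"
    where C: "closed C" "F = fst ` C" "closed C'" "F' = fst ` C'"
    using closed_proj_borel[OF assms(1)] closed_proj_borel[OF assms(2)] unfolding closed_proj_def by blast
  have "borel_sep ((\<lambda>p. fst (fst p)) ` C) ((\<lambda>p. fst (fst p)) ` C')"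
    by (rule lusin_separation) (use C assms(3) in \<open>auto intro!: continuous_intros simp: image_image\<close>)
  then show ?thesis by (simp add: C image_image)
qed

text \<open>The function computing the unique point of a section is a limit of countably valued
  functions which are Borel by Lusin separation.\<close>

lemma borel_fst_image_single_valued:
  fixes F :: "('x::polish_space \<times> 'w::polish_space) set"
  assumes F[measurable]: "F \<in> sets borel" and sv: "\<And>x w w'. (x, w) \<in> F \<Longrightarrow> (x, w') \<in> F \<Longrightarrow> w = w'"
  shows "fst ` F \<in> sets borel"
proof -
  have Fp: "F \<in> sets (borel \<Otimes>\<^sub>M borel)" using F unfolding borel_prod .
  have "\<exists>d :: nat \<Rightarrow> 'w. (\<Union>i. cball (d i) (1 / Suc k)) = UNIV" for k
    using countable_cball_cover[of "1 / Suc k"] by (metis of_nat_0_less_iff zero_less_Suc zero_less_divide_1_iff)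
  then obtain d :: "nat \<Rightarrow> nat \<Rightarrow> 'w" where d: "\<And>k. (\<Union>i. cball (d k i) (1 / Suc k)) = UNIV" by metis
  \<comment> \<open>Sections have at most one point, so no x can have its section point both inside
    and outside the ball: the two projections are disjoint.\<close>
  have "borel_sep (fst ` (F \<inter> (UNIV \<times> cball (d k i) (1 / Suc k)))) (fst ` (F \<inter> (UNIV \<times> - cball (d k i) (1 / Suc k))))" for k i
  proof (rule borel_sep_fst_image)
    have "closed ((UNIV :: 'x set) \<times> cball (d k i) (1 / Suc k))" by (intro closed_Times) auto
    moreover have "open ((UNIV :: 'x set) \<times> (- cball (d k i) (1 / Suc k)))" by (intro open_Times) auto
    ultimately show "F \<inter> (UNIV \<times> cball (d k i) (1 / Suc k)) \<in> sets borel"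
      "F \<inter> (UNIV \<times> - cball (d k i) (1 / Suc k)) \<in> sets borel"
      using F by (auto intro!: sets.Int borel_closed borel_open simp del: Compl_iff)
    show "fst ` (F \<inter> (UNIV \<times> cball (d k i) (1 / Suc k))) \<inter> fst ` (F \<inter> (UNIV \<times> - cball (d k i) (1 / Suc k))) = {}"
      using sv by fastforce
  qed
  then obtain S where S: "\<And>k i. S k i \<in> sets borel"
    "\<And>k i. fst ` (F \<inter> (UNIV \<times> cball (d k i) (1 / Suc k))) \<subseteq> S k i"
    "\<And>k i. S k i \<inter> fst ` (F \<inter> (UNIV \<times> - cball (d k i) (1 / Suc k))) = {}"
    unfolding borel_sep_def by metis
  note S(1)[measurable]
  have Siff: "x \<in> S k i \<longleftrightarrow> w \<in> cball (d k i) (1 / Suc k)" if "(x, w) \<in> F" for x w k i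
  proof
    assume "x \<in> S k i"
    then have "x \<notin> fst ` (F \<inter> (UNIV \<times> - cball (d k i) (1 / Suc k)))" using S(3)[of k i] by blast
    then show "w \<in> cball (d k i) (1 / Suc k)" using that by force
  next
    assume "w \<in> cball (d k i) (1 / Suc k)"
    then have "x \<in> fst ` (F \<inter> (UNIV \<times> cball (d k i) (1 / Suc k)))" using that by force
    then show "x \<in> S k i" using S(2)[of k i] by blast
  qed
  \<comment> \<open>For x in the projection, \<open>g k x\<close> is a centre within
    \<open>1 / Suc k\<close> of the section point; taking the least index makes the choice
    Borel.\<close>
  define g where "g k x = d k (LEAST i. x \<in> S k i)" for k x
  have g[measurable]: "g k \<in> borel_measurable borel" for k
  proof -
    have "(\<lambda>x. LEAST i. x \<in> S k i) \<in> measurable borel (count_space UNIV)" by measurable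
    then show ?thesis unfolding g_def by (rule measurable_compose) simp
  qed
  \<comment> \<open>Off the projection of \<open>F\<close> the sequence \<open>g k x\<close> may
    diverge. Freezing it there makes the limit \<open>h\<close> exist everywhere, so that
    \<open>h\<close> is Borel on the whole space.\<close>
  define g' where "g' k x = (if Cauchy (\<lambda>k. g k x) then g k x else d 0 0)" for k x
  define h where "h x = lim (\<lambda>k. g' k x)" for x
  have "{x \<in> space borel. Cauchy (\<lambda>k. g k x)} \<in> sets borel" by measurable
  then have C[measurable]: "Measurable.pred borel (\<lambda>x. Cauchy (\<lambda>k. g k x))" by (simp add: pred_def)
  have g'[measurable]: "g' k \<in> borel_measurable borel" for k unfolding g'_def by measurable
  have "(\<lambda>k. g' k x) \<longlonglongrightarrow> h x" for x
  proof -
    have "Cauchy (\<lambda>k. g' k x)"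
      by (cases "Cauchy (\<lambda>k. g k x)") (auto simp: g'_def LIMSEQ_imp_Cauchy[OF tendsto_const])
    then show ?thesis unfolding h_def using Cauchy_convergent_iff convergent_LIMSEQ_iff by blast
  qed
  then have h[measurable]: "h \<in> borel_measurable borel"
    by (rule borel_measurable_LIMSEQ_metric[OF g'])
  have hw: "h x = w" if xw: "(x, w) \<in> F" for x w
  proof -
    have "dist (g k x) w \<le> 1 / Suc k" for k
    proof -
      obtain i where "w \<in> cball (d k i) (1 / Suc k)" using d[of k] by blast
      then have "x \<in> S k i" using Siff[OF xw] by blast
      then have "x \<in> S k (LEAST i. x \<in> S k i)" by (rule LeastI)
      then show ?thesis unfolding g_def Siff[OF xw] by simp
    qed
    then have "(\<lambda>k. g k x) \<longlonglongrightarrow> w"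
      unfolding tendsto_dist_iff[of _ w]
      by (intro Lim_null_comparison[OF _ LIMSEQ_Suc[OF lim_1_over_n]]) (auto simp: field_simps)
    then have "Cauchy (\<lambda>k. g k x)" by (rule LIMSEQ_imp_Cauchy)
    with \<open>(\<lambda>k. g k x) \<longlonglongrightarrow> w\<close> show ?thesis unfolding h_def g'_def by (simp add: limI)
  qed
  have "fst ` F = {x \<in> space borel. (x, h x) \<in> F}" using hw by force
  also have "\<dots> \<in> sets borel" using Fp by measurable
  finally show ?thesis .
qed

section \<open>Borel projections of sets with bounded finite sections\<close>

lemma inj_disjoint_balls:
  fixes f :: "nat \<Rightarrow> 'a::metric_space"
  assumes "inj_on f {..<k}"
  shows "\<exists>r>0. \<forall>i<k. \<forall>j<k. i \<noteq> j \<longrightarrow> ball (f i) r \<inter> ball (f j) r = {}"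
proof -
  define P where "P = {(i, j). i < k \<and> j < k \<and> i \<noteq> j}"
  have fin: "finite P" by (rule finite_subset[of _ "{..<k} \<times> {..<k}"]) (auto simp: P_def)
  \<comment> \<open>The inserted 1 keeps the set non-empty when \<open>k\<close> is at most
    1.\<close>
  define r where "r = Min (insert 1 ((\<lambda>(i, j). dist (f i) (f j) / 2) ` P))"
  have "r > 0" unfolding r_def using fin assms by (subst Min_gr_iff) (auto simp: P_def inj_on_def)
  moreover have "ball (f i) r \<inter> ball (f j) r = {}" if "i < k" "j < k" "i \<noteq> j" for i j
  proof (rule equals0I)
    fix x assume x: "x \<in> ball (f i) r \<inter> ball (f j) r"
    have "r \<le> dist (f i) (f j) / 2"
      unfolding r_def using fin that by (intro Min_le) (auto simp: P_def intro!: image_eqI[of _ _ "(i, j)"])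
    then show False using x dist_triangle2[of "f i" "f j" x] by (auto simp: dist_commute)
  qed
  ultimately show ?thesis by blast
qed

text \<open>A point whose section has exactly k elements has a unique k-tuple of section points lying in
  prescribed disjoint basic open sets; the remaining coordinates of the sequence are frozen.\<close>

lemma borel_fst_image_card:
  fixes F :: "('x::polish_space \<times> 'y::polish_space) set"
  assumes F: "F \<in> sets (borel \<Otimes>\<^sub>M borel)" and fin: "\<And>x. finite (F `` {x}) \<and> card (F `` {x}) \<le> k"
  shows "{x. card (F `` {x}) = k} \<in> sets borel"
proof -
  obtain B :: "'y set set" where B: "countable B" "topological_basis B" using ex_countable_basis by blast
  define U where "U = {u \<in> Pi\<^sub>E {..<k} (\<lambda>_. B). \<forall>i<k. \<forall>j<k. i \<noteq> j \<longrightarrow> u i \<inter> u j = {}}"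
  have U: "countable U" unfolding U_def
    by (rule countable_subset[of _ "Pi\<^sub>E {..<k} (\<lambda>_. B)"]) (auto intro!: countable_PiE B)
  define H where "H u = {p :: 'x \<times> (nat \<Rightarrow> 'y). (\<forall>i<k. (fst p, snd p i) \<in> F \<and> snd p i \<in> u i) \<and> (\<forall>i\<ge>k. snd p i = undefined)}"
    for u :: "nat \<Rightarrow> 'y set"
  have co[measurable]: "(\<lambda>p :: 'x \<times> (nat \<Rightarrow> 'y). snd p i) \<in> borel_measurable borel" for i
    by (intro borel_measurable_continuous_onI continuous_on_snd_coordinate)
  have fs[measurable]: "(\<lambda>p :: 'x \<times> (nat \<Rightarrow> 'y). fst p) \<in> borel_measurable borel"
    by (intro borel_measurable_continuous_onI continuous_intros)
  have H: "H u \<in> sets borel" if "u \<in> U" for u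
  proof -
    have u: "u i \<in> sets borel" if "i < k" for i
      using \<open>u \<in> U\<close> that B(2) unfolding U_def by (auto intro!: borel_open topological_basis_open)
    have "H u = (\<Inter>i\<in>{..<k}. (\<lambda>p. (fst p, snd p i)) -` F \<inter> space borel) \<inter>
       (\<Inter>i\<in>{..<k}. (\<lambda>p. snd p i) -` u i \<inter> space borel) \<inter> (\<Inter>i\<in>{k..}. (\<lambda>p. snd p i) -` {undefined} \<inter> space borel)"
      if "k > 0" using that by (auto simp: H_def)
    moreover have "H u = (\<Inter>i\<in>{k..}. (\<lambda>p. snd p i) -` {undefined} \<inter> space borel)" if "k = 0"
      using that by (auto simp: H_def)
    moreover have "(\<lambda>p. (fst p, snd p i)) -` F \<inter> space borel \<in> sets (borel :: ('x \<times> (nat \<Rightarrow> 'y)) measure)" for i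
      using F by measurable
    moreover have "(\<lambda>p. snd p i) -` u i \<inter> space borel \<in> sets (borel :: ('x \<times> (nat \<Rightarrow> 'y)) measure)" if "i < k" for i
      using u[OF that] by measurable
    moreover have "(\<lambda>p. snd p i) -` {undefined} \<inter> space borel \<in> sets (borel :: ('x \<times> (nat \<Rightarrow> 'y)) measure)" for i
      by measurable
    ultimately show ?thesis
      by (cases "k > 0") (auto intro!: sets.Int sets.countable_INT'')
  qed
  \<comment> \<open>Both tuples enumerate the whole section, which has at most \<open>k\<close>
    points, and the disjoint open sets \<open>u i\<close> fix the order of the enumeration.\<close>
  have sv: "f = f'" if u: "u \<in> U" and f: "(x, f) \<in> H u" "(x, f') \<in> H u" for u x f f'
  proof
    have disj: "u i \<inter> u j = {}" if "i < k" "j < k" "i \<noteq> j" for i j using u that unfolding U_def by auto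
    have "inj_on f {..<k}"
      using f(1) disj unfolding H_def inj_on_def by (auto, metis disjoint_iff)
    then have "card (f ` {..<k}) = k" by (simp add: card_image)
    moreover have "f ` {..<k} \<subseteq> F `` {x}" using f(1) unfolding H_def by auto
    ultimately have eq: "F `` {x} = f ` {..<k}" using fin[of x] by (metis card_subset_eq card_mono le_antisym)
    fix i show "f i = f' i"
    proof (cases "i < k")
      case True
      then have "f' i \<in> F `` {x}" "f' i \<in> u i" using f(2) unfolding H_def by auto
      then obtain j where j: "j < k" "f' i = f j" using eq by auto
      then have "f' i \<in> u j" using f(1) unfolding H_def by auto
      then have "i = j" using disj[OF True j(1)] \<open>f' i \<in> u i\<close> by auto
      then show ?thesis using j by simp
    next
      case False then show ?thesis using f unfolding H_def by auto
    qed
  qed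
  have "{x. card (F `` {x}) = k} = (\<Union>u\<in>U. fst ` H u)"
  proof (intro equalityI subsetI)
    fix x assume "x \<in> {x. card (F `` {x}) = k}"
    then obtain f0 where f0: "bij_betw f0 {..<k} (F `` {x})"
      using fin[of x] ex_bij_betw_nat_finite[of "F `` {x}"] by (auto simp: atLeast0LessThan)
    define f where "f i = (if i < k then f0 i else undefined)" for i
    have f: "inj_on f {..<k}" "f ` {..<k} = F `` {x}"
      using f0 unfolding bij_betw_def f_def inj_on_def by auto
    obtain r where r: "r > 0" "\<And>i j. i < k \<Longrightarrow> j < k \<Longrightarrow> i \<noteq> j \<Longrightarrow> ball (f i) r \<inter> ball (f j) r = {}"
      using inj_disjoint_balls[OF f(1)] by blast
    have "\<exists>b\<in>B. f i \<in> b \<and> b \<subseteq> ball (f i) r" for i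
      using topological_basisE[OF B(2), of "ball (f i) r" "f i"] r(1) by (metis centre_in_ball open_ball)
    then obtain b where b: "\<And>i. b i \<in> B" "\<And>i. f i \<in> b i" "\<And>i. b i \<subseteq> ball (f i) r" by metis
    have "restrict b {..<k} \<in> U"
      unfolding U_def using b(1) r(2) b(3) by auto (meson disjoint_iff subsetD)
    moreover have "(x, f) \<in> H (restrict b {..<k})"
    proof -
      have "(x, f i) \<in> F" if "i < k" for i using f(2) that by blast
      moreover have "f i = undefined" if "i \<ge> k" for i using that by (simp add: f_def)
      ultimately show ?thesis using b(2) by (simp add: H_def)
    qed
    ultimately show "x \<in> (\<Union>u\<in>U. fst ` H u)" by force
  next
    fix x assume "x \<in> (\<Union>u\<in>U. fst ` H u)"
    then obtain u f where u: "u \<in> U" and f: "(x, f) \<in> H u" by force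
    have disj: "u i \<inter> u j = {}" if "i < k" "j < k" "i \<noteq> j" for i j using u that unfolding U_def by auto
    have "inj_on f {..<k}"
      using f(1) disj unfolding H_def inj_on_def by (auto, metis disjoint_iff)
    then have "card (f ` {..<k}) = k" by (simp add: card_image)
    moreover have "f ` {..<k} \<subseteq> F `` {x}" using f(1) unfolding H_def by auto
    ultimately show "x \<in> {x. card (F `` {x}) = k}" using fin[of x] by (metis card_mono le_antisym mem_Collect_eq)
  qed
  also have "\<dots> \<in> sets borel"
  proof (rule sets.countable_UN'[OF U], safe)
    fix u assume u: "u \<in> U"
    show "fst ` H u \<in> sets borel"
      by (rule borel_fst_image_single_valued[OF H[OF u]]) (rule sv[OF u])
  qed
  finally show ?thesis .
qed

text \<open>Only the maximal section size is directly accessible, since only there does a tuple of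
  that length exhaust the section. Removing those points lowers the bound by one.\<close>

lemma borel_fst_image_bounded:
  fixes F :: "('x::polish_space \<times> 'y::polish_space) set"
  assumes "F \<in> sets (borel \<Otimes>\<^sub>M borel)" and "\<And>x. finite (F `` {x}) \<and> card (F `` {x}) \<le> k"
  shows "fst ` F \<in> sets borel"
  using assms
proof (induction k arbitrary: F)
  case 0
  then have "F `` {x} = {}" for x by (metis card_0_eq le_zero_eq)
  then have "F = {}" by auto
  then show ?case by simp
next
  case (Suc k)
  define A where "A = {x. card (F `` {x}) = Suc k}"
  have A: "A \<in> sets borel" unfolding A_def by (rule borel_fst_image_card) (rule Suc.prems)+
  define F' where "F' = F - A \<times> UNIV"
  have "F' \<in> sets (borel \<Otimes>\<^sub>M borel)" unfolding F'_def
    by (intro sets.Diff Suc.prems pair_measureI A) auto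
  moreover have "finite (F' `` {x}) \<and> card (F' `` {x}) \<le> k" for x
  proof (cases "x \<in> A")
    case True then have "F' `` {x} = {}" by (auto simp: F'_def)
    then show ?thesis by simp
  next
    case False then have "F' `` {x} = F `` {x}" by (auto simp: F'_def)
    moreover have "card (F `` {x}) \<noteq> Suc k" using False by (simp add: A_def)
    ultimately show ?thesis using Suc.prems(2)[of x] by auto
  qed
  ultimately have "fst ` F' \<in> sets borel" by (rule Suc.IH)
  moreover have "fst ` F = A \<union> fst ` F'"
  proof (intro equalityI subsetI)
    fix x assume "x \<in> A \<union> fst ` F'"
    moreover have "x \<in> fst ` F" if "x \<in> A"
    proof -
      have "F `` {x} \<noteq> {}" using that unfolding A_def by force
      then show ?thesis by force
    qed
    ultimately show "x \<in> fst ` F" unfolding F'_def by auto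
  qed (force simp: F'_def)
  ultimately show ?case using A by simp
qed

text \<open>By symmetry the image of \<open>A\<close> is the first projection of \<open>G\<close>
  restricted to second coordinate in \<open>A\<close>, whose sections are bounded by the
  degree.\<close>

lemma borel_Image:
  fixes G :: "('a::polish_space \<times> 'a) set"
  assumes "sym G" "G \<in> sets (borel \<Otimes>\<^sub>M borel)" "\<And>x. finite (G `` {x}) \<and> card (G `` {x}) \<le> k" "A \<in> sets borel"
  shows "G `` A \<in> sets borel"
proof -
  define F where "F = G \<inter> (UNIV \<times> A)"
  have "F \<in> sets (borel \<Otimes>\<^sub>M borel)" unfolding F_def using assms by (intro sets.Int pair_measureI) auto
  moreover have "finite (F `` {x}) \<and> card (F `` {x}) \<le> k" for x
  proof -
    have "F `` {x} \<subseteq> G `` {x}" unfolding F_def by auto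
    then show ?thesis using assms(3)[of x] by (meson card_mono finite_subset le_trans)
  qed
  ultimately have "fst ` F \<in> sets borel" by (rule borel_fst_image_bounded)
  moreover have "fst ` F = G `` A" using assms(1) unfolding F_def by (force dest: symD)
  ultimately show ?thesis by simp
qed

section \<open>Bounded degree graphs and Borel colourings\<close>

locale bounded_graph =
  fixes G :: "('a \<times> 'a) set" and D :: nat
  assumes sym_G: "sym G" and degree: "finite (G `` {x}) \<and> card (G `` {x}) \<le> D"
begin

text \<open>The loops make the powers increase with \<open>n\<close>, so this is "distance at most
  n" with integer radii, in place of the real bounds of \<open>gdist_le\<close>.\<close>

definition E :: "nat \<Rightarrow> ('a \<times> 'a) set" where
  "E n = (G \<union> Id) ^^ n"

definition core :: "nat \<Rightarrow> 'a set \<Rightarrow> 'a set" where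
  "core n J = {x\<in>J. E n `` {x} \<subseteq> J}"

lemma E_sym: "(x, y) \<in> E n \<Longrightarrow> (y, x) \<in> E n"
proof (induction n arbitrary: x y)
  case 0 then show ?case by (simp add: E_def)
next
  case (Suc n)
  then obtain z where z: "(x, z) \<in> E n" "(z, y) \<in> G \<union> Id" by (auto simp: E_def)
  then have "(z, x) \<in> E n" "(y, z) \<in> G \<union> Id" using Suc.IH sym_G by (auto dest: symD)
  then show ?case unfolding E_def by (meson relpow_Suc_I2)
qed

lemma E_trans: "(x, y) \<in> E m \<Longrightarrow> (y, z) \<in> E n \<Longrightarrow> (x, z) \<in> E (m + n)"
  unfolding E_def by (rule relpow_trans)

lemma E_refl: "(x, x) \<in> E n"
  by (induction n) (auto simp: E_def)

lemma E_mono: assumes "m \<le> n" "(x, y) \<in> E m" shows "(x, y) \<in> E n"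
  using E_trans[OF assms(2) E_refl[of y "n - m"]] assms(1) by simp

lemma E_one: "(x, y) \<in> G \<Longrightarrow> (x, y) \<in> E 1"
  by (simp add: E_def)

lemma E_Suc: "(x, y) \<in> E n \<Longrightarrow> (y, z) \<in> G \<Longrightarrow> (x, z) \<in> E (Suc n)"
  using E_trans[OF _ E_one] by fastforce

lemma E_comp_rel: "(x, y) \<in> E n \<Longrightarrow> (x, y) \<in> comp_rel G"
  unfolding E_def comp_rel_def using relpow_imp_rtrancl by fastforce

lemma E_gdist_le: "(x, y) \<in> E n \<Longrightarrow> real n \<le> r \<Longrightarrow> gdist_le G x y r"
  unfolding gdist_le_def E_def by blast

lemma gdist_le_E: "gdist_le G x y r \<Longrightarrow> r \<le> real n \<Longrightarrow> (x, y) \<in> E n"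
  unfolding gdist_le_def using E_mono unfolding E_def by (metis of_nat_le_iff order_trans)

lemma E_Suc_Image: "E (Suc n) `` A = G `` (E n `` A) \<union> E n `` A"
  by (auto simp: E_def)

lemma finite_Image_G: assumes "finite A" shows "finite (G `` A)" "card (G `` A) \<le> D * card A"
proof -
  have *: "G `` A = (\<Union>x\<in>A. G `` {x})" by blast
  show "finite (G `` A)" unfolding * using assms degree by blast
  have "card (G `` A) \<le> (\<Sum>x\<in>A. card (G `` {x}))" unfolding * using assms by (rule card_UN_le)
  also have "\<dots> \<le> (\<Sum>x\<in>A. D)" using degree by (intro sum_mono) blast
  finally show "card (G `` A) \<le> D * card A" by (simp add: mult.commute)
qed

lemma finite_Image_E: assumes "finite A" shows "finite (E n `` A)" "card (E n `` A) \<le> Suc D ^ n * card A"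
proof -
  have "finite (E n `` A) \<and> card (E n `` A) \<le> Suc D ^ n * card A"
  proof (induction n)
    case 0 have "E 0 `` A = A" by (auto simp: E_def)
    then show ?case using assms by simp
  next
    case (Suc n)
    then have f: "finite (E n `` A)" by simp
    have "card (E (Suc n) `` A) \<le> card (G `` (E n `` A)) + card (E n `` A)"
      unfolding E_Suc_Image by (rule card_Un_le)
    also have "\<dots> \<le> Suc D * card (E n `` A)" using finite_Image_G(2)[OF f] by simp
    also have "\<dots> \<le> Suc D * (Suc D ^ n * card A)" using Suc by (intro mult_left_mono) auto
    finally show ?case using finite_Image_G(1)[OF f] f unfolding E_Suc_Image
      by (simp add: algebra_simps)
  qed
  then show "finite (E n `` A)" "card (E n `` A) \<le> Suc D ^ n * card A" by auto
qed

lemma boundary_reached: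
  assumes "x \<in> J" "(x, y) \<in> E n" "y \<notin> J"
  shows "\<exists>z\<in>gboundary G J. (x, z) \<in> E n"
  using assms
proof (induction n arbitrary: y)
  case 0 then show ?case by (simp add: E_def)
next
  case (Suc n)
  then obtain w where w: "(x, w) \<in> E n" "(w, y) \<in> G \<union> Id" by (auto simp: E_def)
  show ?case
  proof (cases "w \<in> J")
    case True
    then have "w \<in> gboundary G J" using w(2) Suc.prems(3) unfolding gboundary_def by blast
    then show ?thesis using w(1) E_mono[of n "Suc n"] by auto
  next
    case False
    then show ?thesis using Suc.IH[OF Suc.prems(1) w(1)] E_mono[of n "Suc n"] by fastforce
  qed
qed

text \<open>A walk of length \<open>n\<close> out of J meets the boundary, so the lost points lie in
  \<open>n\<close>-balls around boundary points, each of size at most \<open>Suc D ^ n\<close>. Thus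
  a small boundary gives control at any fixed depth.\<close>

lemma card_Diff_core:
  assumes "finite J" shows "card (J - core n J) \<le> Suc D ^ n * card (gboundary G J)"
proof -
  have f: "finite (gboundary G J)" using assms unfolding gboundary_def by simp
  have "J - core n J \<subseteq> E n `` gboundary G J"
    unfolding core_def using boundary_reached E_sym by blast
  then have "card (J - core n J) \<le> card (E n `` gboundary G J)" using f by (intro card_mono finite_Image_E)
  also have "\<dots> \<le> Suc D ^ n * card (gboundary G J)" using f by (rule finite_Image_E)
  finally show ?thesis .
qed

end

text \<open>Borelness of the graph enters as closure of Borel sets under neighbourhoods;
  \<open>borel_Image\<close> supplies it in the end.\<close>

locale borel_bounded_graph = bounded_graph G D for G :: "('a::polish_space \<times> 'a) set" and D +
  assumes Image_G: "A \<in> sets borel \<Longrightarrow> G `` A \<in> sets borel"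
begin

lemma Image_E: "A \<in> sets borel \<Longrightarrow> E n `` A \<in> sets borel"
proof (induction n)
  case 0 have "E 0 `` A = A" by (auto simp: E_def)
  then show ?case using 0 by simp
qed (auto simp: E_Suc_Image intro: Image_G)

end

section \<open>Borel colourings\<close>

lemma countable_basis_sequence:
  obtains U :: "nat \<Rightarrow> 'a::second_countable_topology set"
  where "\<And>n. open (U n)" "\<And>W x. open W \<Longrightarrow> x \<in> W \<Longrightarrow> \<exists>n. x \<in> U n \<and> U n \<subseteq> W"
proof -
  obtain B :: "'a set set" where B: "countable B" "topological_basis B" using ex_countable_basis by blast
  have "B \<noteq> {}" using B(2) topological_basisE[OF B(2), of UNIV] by blast
  show ?thesis
  proof (rule that[of "from_nat_into B"])
    show "open (from_nat_into B n)" for n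
      using B(2) from_nat_into[OF \<open>B \<noteq> {}\<close>] by (rule topological_basis_open)
    show "\<exists>n. x \<in> from_nat_into B n \<and> from_nat_into B n \<subseteq> W" if "open W" "x \<in> W" for W x
      using topological_basisE[OF B(2) that] from_nat_into_surj[OF B(1)] by metis
  qed
qed

text \<open>Kechris, Solecki and Todorcevic: separating each point from its neighbours by a basic open set
  gives a Borel colouring with countably many colours, which is then made finite greedily.\<close>

lemma borel_countable_coloring:
  fixes H :: "('a::polish_space \<times> 'a) set"
  assumes symH: "sym H" and fin: "\<And>x. finite (H `` {x})"
    and bor: "\<And>A. A \<in> sets borel \<Longrightarrow> H `` A \<in> sets borel"
  obtains c :: "'a \<Rightarrow> nat" where "c \<in> measurable borel (count_space UNIV)"
    "\<And>x y. (x, y) \<in> H \<Longrightarrow> x \<noteq> y \<Longrightarrow> c x \<noteq> c y"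
proof -
  obtain U :: "nat \<Rightarrow> 'a set" where U: "\<And>n. open (U n)"
    "\<And>W x. open W \<Longrightarrow> x \<in> W \<Longrightarrow> \<exists>n. x \<in> U n \<and> U n \<subseteq> W"
    using countable_basis_sequence by blast
  \<comment> \<open>Relations such as \<open>E n\<close> contain loops, so a neighbour y different
    from x must be required in a Borel way: some basic \<open>U m\<close> contains y and misses
    x.\<close>
  define Nb where "Nb n = (\<Union>m. H `` (U n \<inter> U m) - U m)" for n
  have Nb: "x \<in> Nb n \<longleftrightarrow> (\<exists>y\<in>U n. y \<noteq> x \<and> (x, y) \<in> H)" for x n
  proof
    assume "x \<in> Nb n" then show "\<exists>y\<in>U n. y \<noteq> x \<and> (x, y) \<in> H"
      unfolding Nb_def using symH by (auto dest: symD)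
  next
    assume "\<exists>y\<in>U n. y \<noteq> x \<and> (x, y) \<in> H"
    then obtain y where y: "y \<in> U n" "y \<noteq> x" "(x, y) \<in> H" by blast
    then obtain m where "y \<in> U m" "x \<notin> U m" using U(2)[of "- {x}" y] by auto
    then show "x \<in> Nb n" unfolding Nb_def using y symH by (auto dest: symD)
  qed
  have [measurable]: "U n \<in> sets borel" for n using U(1) by (rule borel_open)
  have [measurable]: "Nb n \<in> sets borel" for n
    unfolding Nb_def by (intro sets.countable_UN' sets.Diff) (auto intro!: bor)
  define c where "c x = (LEAST n. x \<in> U n \<and> x \<notin> Nb n)" for x
  have "c \<in> measurable borel (count_space UNIV)" unfolding c_def by measurable
  moreover have "c x \<noteq> c y" if "(x, y) \<in> H" "x \<noteq> y" for x y
  proof -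
    have c: "z \<in> U (c z) \<and> z \<notin> Nb (c z)" for z
    proof -
      have "open (- (H `` {z} - {z}))" using fin[of z] by (intro open_Compl finite_imp_closed) auto
      then obtain n where "z \<in> U n" "U n \<subseteq> - (H `` {z} - {z})" using U(2)[of _ z] by blast
      then have "z \<in> U n \<and> z \<notin> Nb n" unfolding Nb by blast
      then show ?thesis unfolding c_def by (rule LeastI)
    qed
    show ?thesis using c[of x] c[of y] that unfolding Nb by metis
  qed
  ultimately show ?thesis using that by blast
qed

lemma borel_finite_coloring:
  fixes H :: "('a::polish_space \<times> 'a) set"
  assumes symH: "sym H" and fin: "\<And>x. finite (H `` {x}) \<and> card (H `` {x}) \<le> M"
    and bor: "\<And>A. A \<in> sets borel \<Longrightarrow> H `` A \<in> sets borel"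
  obtains c :: "'a \<Rightarrow> nat" where "c \<in> measurable borel (count_space UNIV)" "\<And>x. c x \<le> M"
    "\<And>x y. (x, y) \<in> H \<Longrightarrow> x \<noteq> y \<Longrightarrow> c x \<noteq> c y"
proof -
  obtain c0 :: "'a \<Rightarrow> nat" where c0[measurable]: "c0 \<in> measurable borel (count_space UNIV)"
    and c0H: "\<And>x y. (x, y) \<in> H \<Longrightarrow> x \<noteq> y \<Longrightarrow> c0 x \<noteq> c0 y"
    using borel_countable_coloring[OF symH _ bor] fin by blast
  \<comment> \<open>\<open>col n\<close> is final on all points with \<open>c0\<close> below
    \<open>n\<close>. The recursion over stages, instead of over points, yields measurability by
    induction.\<close>
  define col :: "nat \<Rightarrow> 'a \<Rightarrow> nat" where
    "col = rec_nat (\<lambda>x. 0) (\<lambda>n f x. if c0 x = n then LEAST a. x \<notin> H `` {y. c0 y < n \<and> f y = a} else f x)"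
  have col_Suc: "col (Suc n) x = (if c0 x = n then LEAST a. x \<notin> H `` {y. c0 y < n \<and> col n y = a} else col n x)"
    and col_0: "col 0 x = 0" for n x
    by (simp_all add: col_def)
  define c where "c x = col (Suc (c0 x)) x" for x
  have col_c: "col (Suc n) x = c x" if "c0 x \<le> n" for n x
    using that
  proof (induction n)
    case (Suc n)
    show ?case
    proof (cases "c0 x = Suc n")
      case False
      then have "col (Suc (Suc n)) x = col (Suc n) x" by (subst col_Suc) auto
      with False Suc show ?thesis by simp
    qed (simp add: c_def)
  qed (simp add: c_def)
  have c_eq: "c x = (LEAST a. x \<notin> H `` {y. c0 y < c0 x \<and> c y = a})" for x
  proof -
    have "col (c0 x) y = c y" if "c0 y < c0 x" for y
      using col_c[of y "c0 x - 1"] that by simp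
    then have "{y. c0 y < c0 x \<and> col (c0 x) y = a} = {y. c0 y < c0 x \<and> c y = a}" for a by auto
    then show ?thesis unfolding c_def col_Suc by simp
  qed
  have col_meas[measurable]: "col n \<in> measurable borel (count_space UNIV)" for n
  proof (induction n)
    case 0 then show ?case by (simp add: col_0[abs_def])
  next
    case (Suc n)
    note Suc[measurable]
    have "{y \<in> space borel. c0 y < n \<and> col n y = a} \<in> sets borel" for a by measurable
    then have [measurable]: "H `` {y. c0 y < n \<and> col n y = a} \<in> sets borel" for a by (intro bor) simp
    show ?case unfolding col_Suc[abs_def] by measurable
  qed
  have ex: "\<exists>a\<le>M. x \<notin> H `` {y. c0 y < c0 x \<and> c y = a}" for x
  proof (rule ccontr)
    assume *: "\<not> ?thesis"
    have "{..M} \<subseteq> c ` (H `` {x} - {x})"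
    proof
      fix a assume "a \<in> {..M}"
      then obtain y where "(y, x) \<in> H" "c0 y < c0 x" "c y = a" using * by blast
      then show "a \<in> c ` (H `` {x} - {x})" using symH by (auto dest: symD)
    qed
    then have "Suc M \<le> card (c ` (H `` {x} - {x}))" using fin[of x] by (metis card_atMost card_mono finite_Diff finite_imageI)
    also have "\<dots> \<le> card (H `` {x} - {x})" using fin[of x] by (intro card_image_le) auto
    also have "\<dots> \<le> card (H `` {x})" using fin[of x] by (intro card_mono) auto
    finally show False using fin[of x] by simp
  qed
  have "c \<in> measurable borel (count_space UNIV)"
    unfolding c_def by (rule measurable_compose_countable[of "\<lambda>n x. col (Suc n) x"]) measurable
  moreover have "c x \<le> M" for x
    using ex[of x] unfolding c_eq[of x] by (meson Least_le order_trans)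
  moreover have "c x \<noteq> c y" if "(x, y) \<in> H" "x \<noteq> y" for x y
  proof -
    have *: "c u \<noteq> c v" if "(u, v) \<in> H" "c0 u < c0 v" for u v
    proof -
      define P where "P a \<longleftrightarrow> v \<notin> H `` {y. c0 y < c0 v \<and> c y = a}" for a
      have "\<exists>a. P a" using ex[of v] unfolding P_def by blast
      then have "P (LEAST a. P a)" by (rule LeastI_ex)
      moreover have "c v = (LEAST a. P a)" unfolding P_def by (rule c_eq)
      ultimately have "v \<notin> H `` {y. c0 y < c0 v \<and> c y = c v}" unfolding P_def by simp
      then show ?thesis using that by auto
    qed
    show ?thesis using *[of x y] *[of y x] c0H[OF that] that symH by (metis linorder_neqE_nat symD)
  qed
  ultimately show ?thesis by (rule that)
qed

section \<open>Maximal families of Folner sets\<close>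

lemma quotient_Un_disjoint:
  assumes "equiv A r" "equiv B s" "A \<inter> B = {}"
  shows "equiv (A \<union> B) (r \<union> s)" "(A \<union> B) // (r \<union> s) = A // r \<union> B // s"
proof -
  have r: "r \<subseteq> A \<times> A" "s \<subseteq> B \<times> B" using assms(1,2) by (auto dest: equiv_type)
  show "equiv (A \<union> B) (r \<union> s)"
  proof (rule equivI)
    show "r \<union> s \<subseteq> (A \<union> B) \<times> (A \<union> B)" using r by auto
    have "refl_on A r" "refl_on B s" using assms(1,2) by (simp_all add: equiv_def)
    then show "refl_on (A \<union> B) (r \<union> s)" by (auto simp: refl_on_def)
    show "sym (r \<union> s)" using assms(1,2) by (auto simp: equiv_def intro: sym_Un)
    show "trans (r \<union> s)"
    proof (rule transI)
      fix x y z assume "(x, y) \<in> r \<union> s" "(y, z) \<in> r \<union> s"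
      moreover have "trans r" "trans s" using assms(1,2) by (auto simp: equiv_def)
      ultimately show "(x, z) \<in> r \<union> s" using r assms(3) by (blast dest: transD)
    qed
  qed
  have "(r \<union> s) `` {x} = r `` {x}" if "x \<in> A" for x using that r assms(3) by auto
  moreover have "(r \<union> s) `` {x} = s `` {x}" if "x \<in> B" for x using that r assms(3) by auto
  ultimately show "(A \<union> B) // (r \<union> s) = A // r \<union> B // s" unfolding quotient_def by auto
qed

lemma measurable_real_card:
  assumes "finite A" and [measurable]: "\<And>a. a \<in> A \<Longrightarrow> Measurable.pred M (\<lambda>x. P a x)"
  shows "(\<lambda>x. real (card {a\<in>A. P a x})) \<in> borel_measurable M"
proof -
  have "(\<lambda>x. real (card {a\<in>A. P a x})) = (\<lambda>x. \<Sum>a\<in>A. if P a x then 1 else 0)"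
    using assms(1) by (auto simp: sum.If_cases Int_def)
  then show ?thesis by simp
qed

context bounded_graph
begin

lemma finite_ball: "S \<subseteq> E R `` {w} \<Longrightarrow> finite S"
  using finite_Image_E(1)[of "{w}" R] finite_subset by blast

end

context borel_bounded_graph
begin

text \<open>\<open>C\<close> is the region to be avoided and \<open>V\<close> the region covered. A
  tile t stands for the part of \<open>S\<close> not covered before it was added. Keeping
  \<open>S\<close> inside \<open>V\<close> allows boundaries to be measured on \<open>S\<close>,
  which is \<delta>-Folner, rather than on t.\<close>

definition folner_family :: "'a set \<Rightarrow> nat \<Rightarrow> real \<Rightarrow> real \<Rightarrow> 'a set \<Rightarrow> ('a \<times> 'a) set \<Rightarrow> bool" where
  "folner_family C R \<delta> \<epsilon> V T \<longleftrightarrow> V \<in> sets borel \<and> T \<in> sets (borel \<Otimes>\<^sub>M borel) \<and> equiv V T \<and> V \<inter> C = {} \<and>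
     (\<forall>t\<in>V // T. \<exists>S w. t \<subseteq> S \<and> S \<subseteq> V \<and> S \<subseteq> E R `` {w} \<and> folner_set G \<delta> S \<and>
        (1 - \<epsilon>) * card S \<le> card t)"

text \<open>Balls of radius R are rainbow, so a subset of the ball around w is encoded by w and its set of
  colours, and the sets with a given code and centres of one colour are pairwise disjoint.\<close>

lemma folner_family_step:
  assumes c[measurable]: "c \<in> measurable borel (count_space UNIV)" and cN: "\<And>x. c x \<le> (N::nat)"
    and cE: "\<And>x y. (x, y) \<in> E (2 * R + 2) \<Longrightarrow> x \<noteq> y \<Longrightarrow> c x \<noteq> c y"
    and C: "C \<in> sets borel" and VT: "folner_family C R \<delta> \<epsilon> V T" and A: "finite A" and eps: "\<epsilon> \<le> 1"
  shows "\<exists>V' T'. folner_family C R \<delta> \<epsilon> V' T' \<and> V \<subseteq> V' \<and>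
    (\<forall>w. c w = i \<longrightarrow> {y \<in> E R `` {w}. c y \<in> A} \<inter> C = {} \<longrightarrow> folner_set G \<delta> {y \<in> E R `` {w}. c y \<in> A} \<longrightarrow>
       \<epsilon> * card {y \<in> E R `` {w}. c y \<in> A} \<le> card ({y \<in> E R `` {w}. c y \<in> A} \<inter> V'))"
proof -
  define S where "S w = {y \<in> E R `` {w}. c y \<in> A}" for w
  have V: "V \<in> sets borel" "T \<in> sets (borel \<Otimes>\<^sub>M borel)" "equiv V T" "V \<inter> C = {}"
    using VT by (auto simp: folner_family_def)
  have cls: "c -` {a} \<in> sets borel" for a using measurable_sets[OF c, of "{a}"] by simp
  \<comment> \<open>The second radius is \<open>Suc R\<close> because outer neighbours of a subset
    of the R-ball must also be recognised by their colour. The distance is then at most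
    \<open>2 * R + 1\<close>, within the range of the colouring.\<close>
  have inj: "y = z" if "y \<in> E R `` {w}" "z \<in> E (Suc R) `` {w}" "c y = c z" for w y z
  proof -
    have "(y, z) \<in> E (R + Suc R)" using that E_trans E_sym by blast
    then have "(y, z) \<in> E (2 * R + 2)" by (rule E_mono[rotated]) simp
    then show ?thesis using cE that by blast
  qed
  have E1: "y \<in> E (Suc R) `` {w}" if "y \<in> E R `` {w}" for w y using that E_mono[of R "Suc R"] by auto
  have card_c: "card X = card (c ` X)" if "X \<subseteq> E R `` {w}" for X w
    using that inj E1 by (intro card_image[symmetric] inj_onI) blast
  have fS: "finite (S w)" for w by (rule finite_ball[of _ R w]) (auto simp: S_def)
  \<comment> \<open>Counting points becomes counting colours \<open>a\<close> for which w lies in a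
    Borel set, so the cardinality is a Borel function of the centre w.\<close>
  have SI: "card (S w \<inter> Y) = card {a\<in>A. w \<in> E R `` (c -` {a} \<inter> Y)}" for w Y
  proof -
    have "c ` (S w \<inter> Y) = {a\<in>A. w \<in> E R `` (c -` {a} \<inter> Y)}"
      unfolding S_def using E_sym by auto
    then show ?thesis using card_c[of "S w \<inter> Y" w] by (auto simp: S_def)
  qed
  \<comment> \<open>A colour \<open>a\<close> occurs on the boundary when its point has a neighbour
    of some colour \<open>b\<close> outside \<open>S w\<close>. Since colours are injective up to
    radius \<open>Suc R\<close>, being outside can be read off from \<open>b\<close> alone.\<close>
  have bd: "card (gboundary G (S w)) = card {a\<in>A. \<exists>b\<in>{..N}.
      w \<in> E R `` (c -` {a} \<inter> G `` (c -` {b})) \<and> \<not> (b \<in> A \<and> w \<in> E R `` (c -` {b}))}" for w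
  proof -
    have "c ` gboundary G (S w) = {a\<in>A. \<exists>b\<in>{..N}.
      w \<in> E R `` (c -` {a} \<inter> G `` (c -` {b})) \<and> \<not> (b \<in> A \<and> w \<in> E R `` (c -` {b}))}" (is "?L = ?R")
    proof (intro equalityI subsetI)
      fix a assume "a \<in> ?L"
      then obtain y z where y: "y \<in> S w" "(y, z) \<in> G" "z \<notin> S w" "a = c y" unfolding gboundary_def by blast
      have "y \<in> E R `` {w}" using y by (auto simp: S_def)
      then have z: "z \<in> E (Suc R) `` {w}" using y(2) E_Suc by blast
      have "\<not> (c z \<in> A \<and> w \<in> E R `` (c -` {c z}))"
      proof
        assume *: "c z \<in> A \<and> w \<in> E R `` (c -` {c z})"
        then obtain z' where z': "z' \<in> E R `` {w}" "c z' = c z" using E_sym by blast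
        then have "z' = z" using inj z by blast
        then show False using * y(3) z' by (auto simp: S_def)
      qed
      moreover have "w \<in> E R `` (c -` {a} \<inter> G `` (c -` {c z}))"
      proof (rule ImageI)
        show "(y, w) \<in> E R" using y(1) by (auto simp: S_def intro: E_sym)
        show "y \<in> c -` {a} \<inter> G `` (c -` {c z})" using y(2,4) symD[OF sym_G] by blast
      qed
      ultimately show "a \<in> ?R" using y cN by (auto simp: S_def)
    next
      fix a assume "a \<in> ?R"
      then obtain b where a: "a \<in> A" "w \<in> E R `` (c -` {a} \<inter> G `` (c -` {b}))" "\<not> (b \<in> A \<and> w \<in> E R `` (c -` {b}))"
        by blast
      then obtain y z where y: "(y, w) \<in> E R" "c y = a" "(z, y) \<in> G" "c z = b" by blast
      then have "y \<in> S w" "(y, z) \<in> G" using a(1) E_sym sym_G by (auto simp: S_def dest: symD)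
      moreover have "z \<notin> S w"
      proof
        assume z: "z \<in> S w"
        then have "(z, w) \<in> E R" by (auto simp: S_def intro: E_sym)
        then have "w \<in> E R `` (c -` {b})" using y(4) by blast
        then show False using a(3) z y(4) by (auto simp: S_def)
      qed
      ultimately show "a \<in> ?L" using y(2) unfolding gboundary_def by blast
    qed
    then show ?thesis using card_c[of "gboundary G (S w)" w] by (auto simp: S_def gboundary_def)
  qed
  have m1: "(\<lambda>w. real (card (S w \<inter> Y))) \<in> borel_measurable borel" if "Y \<in> sets borel" for Y
    unfolding SI using A
  proof (rule measurable_real_card)
    fix a assume "a \<in> A"
    have [measurable]: "E R `` (c -` {a} \<inter> Y) \<in> sets borel" using cls that by (intro Image_E) auto
    show "Measurable.pred borel (\<lambda>w. w \<in> E R `` (c -` {a} \<inter> Y))" by measurable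
  qed
  have m2: "(\<lambda>w. real (card (gboundary G (S w)))) \<in> borel_measurable borel"
    unfolding bd using A
  proof (rule measurable_real_card)
    fix a assume "a \<in> A"
    have [measurable]: "E R `` (c -` {a} \<inter> G `` (c -` {b})) \<in> sets borel" for b
      using cls by (intro Image_E sets.Int Image_G) auto
    have [measurable]: "E R `` (c -` {b}) \<in> sets borel" for b using cls by (intro Image_E)
    show "Measurable.pred borel (\<lambda>w. \<exists>b\<in>{..N}.
       w \<in> E R `` (c -` {a} \<inter> G `` (c -` {b})) \<and> \<not> (b \<in> A \<and> w \<in> E R `` (c -` {b})))" by measurable
  qed
  \<comment> \<open>Centres whose set is admissible but still too thinly covered. They share the
    colour \<open>i\<close>, hence their R-balls are pairwise disjoint and all these sets can be
    added at once.\<close>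
  define W where "W = {w. c w = i \<and> S w \<inter> C = {} \<and> folner_set G \<delta> (S w) \<and> card (S w \<inter> V) < \<epsilon> * card (S w)}"
  have W[measurable]: "W \<in> sets borel"
  proof -
    have W_eq: "W = {w \<in> space borel. c w = i \<and> real (card (S w \<inter> C)) = 0 \<and> real (card (S w \<inter> UNIV)) \<noteq> 0 \<and>
      real (card (gboundary G (S w))) / real (card (S w \<inter> UNIV)) < \<delta> \<and>
      real (card (S w \<inter> V)) < \<epsilon> * real (card (S w \<inter> UNIV))}"
      unfolding W_def folner_set_def using fS by auto
    note m1[OF C, measurable] m1[OF V(1), measurable] m2[measurable]
    have [measurable]: "(\<lambda>w. real (card (S w \<inter> UNIV))) \<in> borel_measurable borel" by (rule m1) simp
    show ?thesis unfolding W_eq by measurable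
  qed
  have uniq: "w = w'" if "w \<in> W" "w' \<in> W" "(w, x) \<in> E R" "(w', x) \<in> E R" for w w' x
  proof -
    have "(w, w') \<in> E (R + R)" by (rule E_trans[OF that(3) E_sym[OF that(4)]])
    then have "(w, w') \<in> E (2 * R + 2)" by (rule E_mono[rotated]) simp
    then show ?thesis using cE[of w w'] that(1,2) unfolding W_def by auto
  qed
  define V2 where "V2 = (\<Union>w\<in>W. S w) - V"
  define T2 where "T2 = {(x, y). \<exists>w\<in>W. x \<in> S w - V \<and> y \<in> S w - V}"
  have "(\<Union>w\<in>W. S w) = E R `` W \<inter> c -` A" unfolding S_def by auto
  moreover have "c -` A \<in> sets borel" using measurable_sets[OF c, of A] by simp
  ultimately have V2: "V2 \<in> sets borel" unfolding V2_def using W V(1) Image_E by auto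
  obtain U :: "nat \<Rightarrow> 'a set" where U: "\<And>n. open (U n)"
    "\<And>X x. open X \<Longrightarrow> x \<in> X \<Longrightarrow> \<exists>n. x \<in> U n \<and> U n \<subseteq> X"
    using countable_basis_sequence by blast
  have T2: "T2 \<in> sets (borel \<Otimes>\<^sub>M borel)"
  proof -
    have [measurable]: "E R `` (W \<inter> U n) \<in> sets borel" for n
      using U(1) W by (intro Image_E) auto
    \<comment> \<open>Two points belong to the same new tile when their centres in \<open>W\<close>
      agree. Centres are compared through the basic open sets containing them, which makes the
      relation Borel.\<close>
    have "T2 = {p \<in> space (borel \<Otimes>\<^sub>M borel). fst p \<in> V2 \<and> snd p \<in> V2 \<and>
      (\<forall>n. fst p \<in> E R `` (W \<inter> U n) \<longleftrightarrow> snd p \<in> E R `` (W \<inter> U n))}"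
    proof (intro equalityI subsetI)
      fix p assume "p \<in> T2"
      then obtain x y w where p: "p = (x, y)" "w \<in> W" "x \<in> S w - V" "y \<in> S w - V" unfolding T2_def by auto
      have "z \<in> E R `` (W \<inter> U n) \<longleftrightarrow> w \<in> U n" if "z \<in> S w" for z n
        using that uniq[OF p(2)] p(2) unfolding S_def by blast
      then show "p \<in> {p \<in> space (borel \<Otimes>\<^sub>M borel). fst p \<in> V2 \<and> snd p \<in> V2 \<and>
        (\<forall>n. fst p \<in> E R `` (W \<inter> U n) \<longleftrightarrow> snd p \<in> E R `` (W \<inter> U n))}"
        using p unfolding V2_def by (auto simp: space_pair_measure)
    next
      fix p assume p: "p \<in> {p \<in> space (borel \<Otimes>\<^sub>M borel). fst p \<in> V2 \<and> snd p \<in> V2 \<and>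
        (\<forall>n. fst p \<in> E R `` (W \<inter> U n) \<longleftrightarrow> snd p \<in> E R `` (W \<inter> U n))}"
      then obtain w w' where w: "w \<in> W" "fst p \<in> S w - V" "w' \<in> W" "snd p \<in> S w' - V" unfolding V2_def by blast
      have "w = w'"
      proof (rule ccontr)
        assume "w \<noteq> w'"
        then obtain n where n: "w \<in> U n" "w' \<notin> U n" using U(2)[of "- {w'}" w] by auto
        then have "fst p \<in> E R `` (W \<inter> U n)" using w unfolding S_def by blast
        then have "snd p \<in> E R `` (W \<inter> U n)" using p by blast
        then obtain v where "v \<in> W" "v \<in> U n" "(v, snd p) \<in> E R" by blast
        then show False using uniq[of v w' "snd p"] w n unfolding S_def by blast
      qed
      then show "p \<in> T2" using w unfolding T2_def by (cases p) auto
    qed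
    also have "\<dots> \<in> sets (borel \<Otimes>\<^sub>M borel)" using V2 by measurable
    finally show ?thesis .
  qed
  have T2w: "T2 `` {x} = S w - V" if "w \<in> W" "x \<in> S w - V" for w x
    using that uniq[OF that(1)] unfolding T2_def S_def by auto
  have eq2: "equiv V2 T2"
  proof (rule equivI)
    show "T2 \<subseteq> V2 \<times> V2" "refl_on V2 T2" "sym T2" unfolding T2_def V2_def refl_on_def sym_def by auto
    show "trans T2"
    proof (rule transI)
      fix x y z assume "(x, y) \<in> T2" "(y, z) \<in> T2"
      moreover from \<open>(x, y) \<in> T2\<close> obtain w where "w \<in> W" "x \<in> S w - V" "y \<in> S w - V" unfolding T2_def by auto
      ultimately show "(x, z) \<in> T2" using T2w by blast
    qed
  qed
  have disj: "V \<inter> V2 = {}" unfolding V2_def by auto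
  note q = quotient_Un_disjoint[OF V(3) eq2 disj]
  have SV: "S w \<subseteq> V \<union> V2" if "w \<in> W" for w using that unfolding V2_def by auto
  have new: "\<exists>S w. t \<subseteq> S \<and> S \<subseteq> V \<union> V2 \<and> S \<subseteq> E R `` {w} \<and> folner_set G \<delta> S \<and> (1 - \<epsilon>) * card S \<le> card t"
    if "t \<in> V2 // T2" for t
  proof -
    obtain x w where w: "w \<in> W" "x \<in> S w - V" "t = T2 `` {x}" using \<open>t \<in> V2 // T2\<close> unfolding quotient_def V2_def by blast
    have t: "t = S w - V" using T2w[OF w(1,2)] w(3) by simp
    have "card (S w - V) = card (S w) - card (S w \<inter> V)" using fS by (simp add: card_Diff_subset_Int)
    moreover have "card (S w \<inter> V) < \<epsilon> * card (S w)" using w unfolding W_def by auto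
    moreover have "card (S w \<inter> V) \<le> card (S w)" using fS by (intro card_mono) auto
    ultimately have "(1 - \<epsilon>) * card (S w) \<le> card t" unfolding t by (simp add: of_nat_diff algebra_simps)
    moreover have "folner_set G \<delta> (S w)" using w unfolding W_def by auto
    moreover have "S w \<subseteq> E R `` {w}" unfolding S_def by auto
    ultimately show ?thesis using SV[OF w(1)] t by (intro exI[of _ "S w"] exI[of _ w]) auto
  qed
  have "folner_family C R \<delta> \<epsilon> (V \<union> V2) (T \<union> T2)"
    unfolding folner_family_def q(2)
  proof (intro conjI ballI q(1))
    show "V \<union> V2 \<in> sets borel" "T \<union> T2 \<in> sets (borel \<Otimes>\<^sub>M borel)" using V V2 T2 by auto
    show "(V \<union> V2) \<inter> C = {}" using V(4) unfolding V2_def W_def by auto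
    fix t assume "t \<in> V // T \<union> V2 // T2"
    then show "\<exists>S w. t \<subseteq> S \<and> S \<subseteq> V \<union> V2 \<and> S \<subseteq> E R `` {w} \<and> folner_set G \<delta> S \<and> (1 - \<epsilon>) * card S \<le> card t"
    proof
      assume "t \<in> V // T"
      then show ?thesis using VT unfolding folner_family_def by (meson le_supI1)
    qed (rule new)
  qed
  \<comment> \<open>Either w was in \<open>W\<close> and its set is now covered completely, or the
    set was already dense enough.\<close>
  moreover have "\<epsilon> * card (S w) \<le> card (S w \<inter> (V \<union> V2))"
    if "c w = i" "S w \<inter> C = {}" "folner_set G \<delta> (S w)" for w
  proof (cases "w \<in> W")
    case True
    then have "S w \<inter> (V \<union> V2) = S w" using SV by blast
    then show ?thesis using mult_right_mono[OF eps, of "real (card (S w))"] by simp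
  next
    case False
    then have "\<epsilon> * card (S w) \<le> card (S w \<inter> V)" using that unfolding W_def by auto
    also have "\<dots> \<le> card (S w \<inter> (V \<union> V2))" using fS by (intro of_nat_mono card_mono) auto
    finally show ?thesis .
  qed
  ultimately show ?thesis unfolding S_def by (intro exI[of _ "V \<union> V2"] exI[of _ "T \<union> T2"]) auto
qed

text \<open>There are finitely many codes (colour of the centre, set of colours). One step makes all
  admissible sets with a given code dense in \<open>V\<close>, and density survives enlarging
  \<open>V\<close>, so a single pass through the codes suffices.\<close>

lemma maximal_folner_family:
  assumes C: "C \<in> sets borel" and eps: "\<epsilon> \<le> 1"
  obtains V T where "folner_family C R \<delta> \<epsilon> V T"
    "\<And>S w. S \<subseteq> E R `` {w} \<Longrightarrow> S \<inter> C = {} \<Longrightarrow> folner_set G \<delta> S \<Longrightarrow> \<epsilon> * card S \<le> card (S \<inter> V)"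
proof -
  define N where "N = Suc D ^ (2 * R + 2)"
  obtain c :: "'a \<Rightarrow> nat" where c: "c \<in> measurable borel (count_space UNIV)" "\<And>x. c x \<le> N"
    "\<And>x y. (x, y) \<in> E (2 * R + 2) \<Longrightarrow> x \<noteq> y \<Longrightarrow> c x \<noteq> c y"
  proof (rule borel_finite_coloring[of "E (2 * R + 2)" N])
    show "sym (E (2 * R + 2))" by (rule symI, rule E_sym)
    show "finite (E (2 * R + 2) `` {x}) \<and> card (E (2 * R + 2) `` {x}) \<le> N" for x
      using finite_Image_E[of "{x}" "2 * R + 2"] by (simp add: N_def)
  qed (use Image_E in auto)
  define dense where "dense V i A \<longleftrightarrow> (\<forall>w. c w = i \<longrightarrow> {y \<in> E R `` {w}. c y \<in> A} \<inter> C = {} \<longrightarrow>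
      folner_set G \<delta> {y \<in> E R `` {w}. c y \<in> A} \<longrightarrow>
      \<epsilon> * card {y \<in> E R `` {w}. c y \<in> A} \<le> card ({y \<in> E R `` {w}. c y \<in> A} \<inter> V))" for V i A
  have dense_mono: "dense V' i A" if "dense V i A" "V \<subseteq> V'" for V V' i A
    unfolding dense_def
  proof (intro allI impI)
    fix w assume *: "c w = i" "{y \<in> E R `` {w}. c y \<in> A} \<inter> C = {}" "folner_set G \<delta> {y \<in> E R `` {w}. c y \<in> A}"
    have "card ({y \<in> E R `` {w}. c y \<in> A} \<inter> V) \<le> card ({y \<in> E R `` {w}. c y \<in> A} \<inter> V')"
      by (rule card_mono, rule finite_ball[of _ R w]) (use that(2) in auto)
    moreover have "\<epsilon> * card {y \<in> E R `` {w}. c y \<in> A} \<le> card ({y \<in> E R `` {w}. c y \<in> A} \<inter> V)"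
      using that(1) * unfolding dense_def by simp
    ultimately show "\<epsilon> * card {y \<in> E R `` {w}. c y \<in> A} \<le> card ({y \<in> E R `` {w}. c y \<in> A} \<inter> V')" by linarith
  qed
  have "\<exists>V T. folner_family C R \<delta> \<epsilon> V T \<and> (\<forall>k\<in>K. dense V (fst k) (snd k))"
    if "finite K" "K \<subseteq> {..N} \<times> Pow {..N}" for K
    using that
  proof (induction K)
    case empty
    have "folner_family C R \<delta> \<epsilon> {} {}" unfolding folner_family_def by (auto simp: equiv_def refl_on_def)
    then show ?case by auto
  next
    case (insert k K)
    have A: "finite (snd k)" using insert.prems finite_subset[OF _ finite_atMost[of N]] by auto
    have "K \<subseteq> {..N} \<times> Pow {..N}" using insert.prems by simp
    then obtain V T where VT: "folner_family C R \<delta> \<epsilon> V T" "\<forall>k\<in>K. dense V (fst k) (snd k)"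
      using insert.IH by blast
    obtain V' T' where V': "folner_family C R \<delta> \<epsilon> V' T'" "V \<subseteq> V'" "dense V' (fst k) (snd k)"
      using folner_family_step[OF c C VT(1) A eps, of "fst k"] unfolding dense_def by blast
    then show ?case using dense_mono[OF _ V'(2)] VT(2) by (intro exI[of _ V'] exI[of _ T']) simp
  qed
  from this[of "{..N} \<times> Pow {..N}"] obtain V T where VT: "folner_family C R \<delta> \<epsilon> V T"
    and dense: "\<forall>k\<in>{..N} \<times> Pow {..N}. dense V (fst k) (snd k)"
    by auto
  have "\<epsilon> * card S \<le> card (S \<inter> V)" if S: "S \<subseteq> E R `` {w}" "S \<inter> C = {}" "folner_set G \<delta> S" for S w
  proof -
    have "y \<in> S" if "y \<in> E R `` {w}" "c y \<in> c ` S" for y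
    proof -
      from that(2) obtain z where z: "z \<in> S" "c y = c z" by auto
      have "(y, w) \<in> E R" "(w, z) \<in> E R" using that(1) S(1) z(1) E_sym[of w y] by auto
      then have "(y, z) \<in> E (R + R)" by (rule E_trans)
      then have "(y, z) \<in> E (2 * R + 2)" by (rule E_mono[rotated]) simp
      then show ?thesis using c(3) z by blast
    qed
    \<comment> \<open>The ball is rainbow, so every subset of it is recovered from its colours: each
      \<open>S\<close> really has a code.\<close>
    then have eq: "{y \<in> E R `` {w}. c y \<in> c ` S} = S" using S by auto
    have "dense V (c w) (c ` S)" using bspec[OF dense, of "(c w, c ` S)"] c(2) by auto
    from this[unfolded dense_def, rule_format, of w] show ?thesis using S unfolding eq by simp
  qed
  with VT show ?thesis using that by blast
qed

end

section \<open>Density of maximal families\<close>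

lemma sum_indicator_card:
  "finite Q \<Longrightarrow> (\<Sum>x\<in>Q. indicator V x :: real) = card (Q \<inter> V)"
  by (simp add: indicator_def sum.If_cases)

context bounded_graph
begin

lemma card_boundary_le:
  assumes "finite Q" "S \<subseteq> Q"
  shows "real (card (gboundary G S)) \<le> (\<Sum>x\<in>Q. \<Sum>z\<in>G `` {x}. \<bar>indicator S x - indicator S z\<bar>)"
proof -
  have fin: "finite (gboundary G S)" "gboundary G S \<subseteq> Q"
    using assms finite_subset[OF assms(2,1)] unfolding gboundary_def by auto
  have "real (card (gboundary G S)) = (\<Sum>x\<in>gboundary G S. 1)" by simp
  also have "\<dots> \<le> (\<Sum>x\<in>gboundary G S. \<Sum>z\<in>G `` {x}. \<bar>indicator S x - indicator S z\<bar>)"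
  proof (rule sum_mono)
    fix x assume "x \<in> gboundary G S"
    then obtain z where z: "x \<in> S" "z \<in> G `` {x}" "z \<notin> S" unfolding gboundary_def by blast
    then have "1 = \<bar>indicator S x - indicator S z :: real\<bar>" by simp
    also have "\<dots> \<le> (\<Sum>z\<in>G `` {x}. \<bar>indicator S x - indicator S z\<bar>)"
      using degree z(2) by (intro member_le_sum) auto
    finally show "1 \<le> (\<Sum>z\<in>G `` {x}. \<bar>indicator S x - indicator S z :: real\<bar>)" .
  qed
  also have "\<dots> \<le> (\<Sum>x\<in>Q. \<Sum>z\<in>G `` {x}. \<bar>indicator S x - indicator S z\<bar>)"
    using fin assms(1) by (intro sum_mono2 sum_nonneg) auto
  finally show ?thesis .
qed

text \<open>Layer-cake argument: peeling off the smallest positive value splits f, its total variation and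
  its mass on V additively, so an inequality for superlevel sets passes to f.\<close>

lemma superlevel_sum_le:
  fixes f :: "'a \<Rightarrow> real" and \<epsilon> \<kappa> :: real
  assumes Q: "finite Q" and \<kappa>: "\<kappa> \<ge> 0" and nonneg: "\<And>x. f x \<ge> 0" and supp: "\<And>x. x \<notin> Q \<Longrightarrow> f x = 0"
    and level: "\<And>t. t \<ge> 0 \<Longrightarrow> {x. f x > t} \<noteq> {} \<Longrightarrow>
      \<epsilon> * card {x. f x > t} - \<kappa> * card (gboundary G {x. f x > t}) \<le> card ({x. f x > t} \<inter> V)"
  shows "\<epsilon> * (\<Sum>x\<in>Q. f x) - \<kappa> * (\<Sum>x\<in>Q. \<Sum>z\<in>G `` {x}. \<bar>f x - f z\<bar>) \<le> (\<Sum>x\<in>Q. f x * indicator V x)"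
  using nonneg supp level
proof (induction "card (f ` Q - {0})" arbitrary: f rule: less_induct)
  case less
  define S where "S = {x. f x > 0}"
  have SQ: "S \<subseteq> Q" unfolding S_def using less.prems(2) by force
  have f0: "f x = 0" if "x \<notin> S" for x using that less.prems(1)[of x] unfolding S_def by auto
  show ?case
  proof (cases "S = {}")
    case True
    then have "f x = 0" for x using f0 by auto
    then show ?thesis by simp
  next
    case False
    have fS: "finite S" using SQ Q finite_subset by blast
    define m where "m = Min (f ` S)"
    have "m \<in> f ` S" unfolding m_def using fS False by (intro Min_in) auto
    then obtain x0 where x0: "x0 \<in> S" "f x0 = m" by auto
    have m: "m > 0" using x0 unfolding S_def by auto
    have mle: "m \<le> f x" if "x \<in> S" for x unfolding m_def using fS that by simp
    define f' where "f' x = f x - m * indicator S x" for x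
    have f'0: "f' x \<ge> 0" for x using mle[of x] less.prems(1)[of x] unfolding f'_def by (cases "x \<in> S") auto
    have f'Q: "f' x = 0" if "x \<notin> Q" for x
    proof -
      have "x \<notin> S" using SQ that by blast
      then show ?thesis using less.prems(2)[OF that] unfolding f'_def by simp
    qed
    \<comment> \<open>Superlevel sets of \<open>f'\<close> are superlevel sets of \<open>f\<close>
      at a level shifted by \<open>m\<close>, so the hypothesis on levels is inherited.\<close>
    have lev: "{x. f' x > t} = {x. f x > t + m}" if "t \<ge> 0" for t
    proof (intro Collect_cong)
      fix x show "f' x > t \<longleftrightarrow> f x > t + m"
        using that m f0[of x] unfolding f'_def by (cases "x \<in> S") auto
    qed
    \<comment> \<open>The induction measure drops: the value \<open>m\<close> becomes 0 and every
      other positive value is merely shifted.\<close>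
    have "card (f' ` Q - {0}) < card (f ` Q - {0})"
    proof -
      have "f' ` Q - {0} \<subseteq> (\<lambda>v. v - m) ` (f ` Q - {0, m})"
      proof
        fix v assume "v \<in> f' ` Q - {0}"
        then obtain x where x: "x \<in> Q" "v = f' x" "f' x \<noteq> 0" by auto
        then have "x \<in> S" using f0[of x] unfolding f'_def by (cases "x \<in> S") auto
        then have "v = f x - m" "f x \<in> f ` Q - {0, m}" using x unfolding f'_def S_def by auto
        then show "v \<in> (\<lambda>v. v - m) ` (f ` Q - {0, m})" by blast
      qed
      then have "card (f' ` Q - {0}) \<le> card ((\<lambda>v. v - m) ` (f ` Q - {0, m}))" using Q by (intro card_mono) auto
      also have "\<dots> \<le> card (f ` Q - {0, m})" using Q by (intro card_image_le) auto
      also have "\<dots> < card (f ` Q - {0})"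
      proof (rule psubset_card_mono)
        have "m \<in> f ` Q - {0}" using x0 SQ m by auto
        then show "f ` Q - {0, m} \<subset> f ` Q - {0}" by blast
      qed (use Q in simp)
      finally show ?thesis .
    qed
    then have IH: "\<epsilon> * (\<Sum>x\<in>Q. f' x) - \<kappa> * (\<Sum>x\<in>Q. \<Sum>z\<in>G `` {x}. \<bar>f' x - f' z\<bar>) \<le> (\<Sum>x\<in>Q. f' x * indicator V x)"
      by (rule less.hyps[OF _ f'0 f'Q]) (use lev less.prems(3) m in auto)
    have s1: "(\<Sum>x\<in>Q. f x) = (\<Sum>x\<in>Q. f' x) + m * card S"
    proof -
      have "(\<Sum>x\<in>Q. f x) = (\<Sum>x\<in>Q. f' x + m * indicator S x)" by (simp add: f'_def)
      also have "\<dots> = (\<Sum>x\<in>Q. f' x) + m * card S"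
        using Q SQ by (simp add: sum.distrib sum_distrib_left[symmetric] sum_indicator_card Int_absorb1)
      finally show ?thesis .
    qed
    have s2: "(\<Sum>x\<in>Q. f x * indicator V x) = (\<Sum>x\<in>Q. f' x * indicator V x) + m * card (S \<inter> V)"
    proof -
      have "(\<Sum>x\<in>Q. f x * indicator V x) = (\<Sum>x\<in>Q. f' x * indicator V x + m * indicator (S \<inter> V) x)"
        by (intro sum.cong) (auto simp: f'_def indicator_def)
      also have "\<dots> = (\<Sum>x\<in>Q. f' x * indicator V x) + m * card (S \<inter> V)"
        using Q SQ by (simp add: sum.distrib sum_distrib_left[symmetric] sum_indicator_card Int_absorb1 le_infI1)
      finally show ?thesis .
    qed
    \<comment> \<open>\<open>f\<close> is at least \<open>m\<close> on \<open>S\<close> and 0 off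
      it, so the variations of \<open>f'\<close> and of the removed layer add without
      cancellation.\<close>
    have "\<bar>f x - f z\<bar> = \<bar>f' x - f' z\<bar> + m * \<bar>indicator S x - indicator S z\<bar>" for x z
      using m mle[of x] mle[of z] f0[of x] f0[of z] unfolding f'_def
      by (cases "x \<in> S"; cases "z \<in> S") auto
    then have "(\<Sum>x\<in>Q. \<Sum>z\<in>G `` {x}. \<bar>f x - f z\<bar>) = (\<Sum>x\<in>Q. \<Sum>z\<in>G `` {x}. \<bar>f' x - f' z\<bar>) +
        m * (\<Sum>x\<in>Q. \<Sum>z\<in>G `` {x}. \<bar>indicator S x - indicator S z\<bar>)"
      by (simp add: sum.distrib sum_distrib_left)
    moreover have "m * card (gboundary G S) \<le> m * (\<Sum>x\<in>Q. \<Sum>z\<in>G `` {x}. \<bar>indicator S x - indicator S z\<bar>)"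
      using card_boundary_le[OF Q SQ] m by (intro mult_left_mono) auto
    ultimately have "(\<Sum>x\<in>Q. \<Sum>z\<in>G `` {x}. \<bar>f x - f z\<bar>) \<ge> (\<Sum>x\<in>Q. \<Sum>z\<in>G `` {x}. \<bar>f' x - f' z\<bar>) + m * card (gboundary G S)"
      by linarith
    from mult_left_mono[OF this \<kappa>]
    have s3: "\<kappa> * (\<Sum>x\<in>Q. \<Sum>z\<in>G `` {x}. \<bar>f x - f z\<bar>) \<ge>
        \<kappa> * (\<Sum>x\<in>Q. \<Sum>z\<in>G `` {x}. \<bar>f' x - f' z\<bar>) + \<kappa> * (m * card (gboundary G S))"
      by (simp only: distrib_left)
    have "\<epsilon> * card S - \<kappa> * card (gboundary G S) \<le> card (S \<inter> V)"
      using less.prems(3)[of 0] False unfolding S_def by simp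
    then have "m * (\<epsilon> * card S - \<kappa> * card (gboundary G S)) \<le> m * card (S \<inter> V)" using m by (intro mult_left_mono) auto
    then show ?thesis using IH s3 unfolding s1 s2 by (simp add: algebra_simps)
  qed
qed

text \<open>The columns of q form a fractional tiling: they sum to 1, and on average over a set they have
  small variation, so their superlevel sets are mostly Folner.\<close>

lemma card_Int_ge_of_dense:
  fixes q :: "'a \<Rightarrow> 'a \<Rightarrow> real" and \<epsilon> \<delta> \<eta> :: real
  assumes q: "\<And>x y. q x y \<ge> 0" "\<And>x y. (x, y) \<notin> E R \<Longrightarrow> q x y = 0" "\<And>x. (\<Sum>y\<in>E R `` {x}. q x y) = 1"
    and var: "\<And>x z Y. (x, z) \<in> G \<Longrightarrow> finite Y \<Longrightarrow> (\<Sum>y\<in>Y. \<bar>q x y - q z y\<bar>) \<le> \<eta>"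
    and dense: "\<And>S w. S \<subseteq> E R `` {w} \<Longrightarrow> S \<inter> C = {} \<Longrightarrow> folner_set G \<delta> S \<Longrightarrow> \<epsilon> * card S \<le> card (S \<inter> V)"
    and J: "finite J" "J \<inter> C = {}" and pos: "\<delta> > 0" "\<epsilon> \<ge> 0" "\<eta> \<ge> 0"
  shows "\<epsilon> * card (core (2 * R) J) - \<epsilon> / \<delta> * (D * \<eta> * card J) \<le> card (J \<inter> V)"
proof -
  \<comment> \<open>For w in this core the whole column of w is supported in J, so its superlevel
    sets avoid \<open>C\<close>. Points at depth \<open>2 * R\<close> have their entire row inside
    \<open>J0\<close>.\<close>
  define J0 where "J0 = core R J"
  have J0: "finite J0" unfolding J0_def core_def using J by simp
  have col: "\<epsilon> * (\<Sum>x\<in>J. q x w) - \<epsilon> / \<delta> * (\<Sum>x\<in>J. \<Sum>z\<in>G `` {x}. \<bar>q x w - q z w\<bar>) \<le> (\<Sum>x\<in>J. q x w * indicator V x)"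
    if w: "w \<in> J0" for w
  proof (rule superlevel_sum_le[OF J(1), where f = "\<lambda>x. q x w" and \<kappa> = "\<epsilon> / \<delta>" and \<epsilon> = \<epsilon> and V = V])
    have wJ: "E R `` {w} \<subseteq> J" using w unfolding J0_def core_def by auto
    show "\<epsilon> / \<delta> \<ge> 0" using pos by simp
    show "q x w \<ge> 0" for x by (rule q)
    show "q x w = 0" if "x \<notin> J" for x using that wJ E_sym q(2) by blast
    fix t :: real assume t: "t \<ge> 0" "{x. q x w > t} \<noteq> {}"
    let ?S = "{x. q x w > t}"
    have S: "?S \<subseteq> E R `` {w}"
    proof
      fix x assume "x \<in> ?S"
      then have "q x w \<noteq> 0" using t by auto
      then have "(x, w) \<in> E R" using q(2) by blast
      then show "x \<in> E R `` {w}" using E_sym by blast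
    qed
    have fS: "finite ?S" using finite_ball[OF S] .
    show "\<epsilon> * card ?S - \<epsilon> / \<delta> * card (gboundary G ?S) \<le> card (?S \<inter> V)"
    proof (cases "folner_set G \<delta> ?S")
      case True
      have "?S \<inter> C = {}" using S wJ J(2) by blast
      then have "\<epsilon> * card ?S \<le> card (?S \<inter> V)" using dense[OF S _ True] by blast
      moreover have "\<epsilon> / \<delta> * card (gboundary G ?S) \<ge> 0" using pos by simp
      ultimately show ?thesis by linarith
    next
      \<comment> \<open>A level that is not Folner has boundary at least \<delta> times its size, so
        the factor \<open>\<epsilon> / \<delta>\<close> makes the left side non-positive.\<close>
      case False
      have "card ?S > 0" using fS t(2) by (simp add: card_gt_0_iff)
      then have "\<delta> * card ?S \<le> card (gboundary G ?S)"
      proof -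
        have "\<not> card (gboundary G ?S) / card ?S < \<delta>"
          using False fS t(2) unfolding folner_set_def by blast
        then show ?thesis using \<open>card ?S > 0\<close> by (simp add: field_simps)
      qed
      then have "\<epsilon> / \<delta> * (\<delta> * card ?S) \<le> \<epsilon> / \<delta> * card (gboundary G ?S)" using pos by (intro mult_left_mono) auto
      then show ?thesis using pos by simp
    qed
  qed
  have "(\<Sum>w\<in>J0. \<epsilon> * (\<Sum>x\<in>J. q x w) - \<epsilon> / \<delta> * (\<Sum>x\<in>J. \<Sum>z\<in>G `` {x}. \<bar>q x w - q z w\<bar>)) \<le> (\<Sum>w\<in>J0. \<Sum>x\<in>J. q x w * indicator V x)"
    by (intro sum_mono col)
  then have total: "\<epsilon> * (\<Sum>w\<in>J0. \<Sum>x\<in>J. q x w) - \<epsilon> / \<delta> * (\<Sum>w\<in>J0. \<Sum>x\<in>J. \<Sum>z\<in>G `` {x}. \<bar>q x w - q z w\<bar>)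
      \<le> (\<Sum>w\<in>J0. \<Sum>x\<in>J. q x w * indicator V x)"
    by (simp add: sum_subtractf sum_distrib_left)
  \<comment> \<open>Rows have total mass 1, so the columns together count each point of
    \<open>J \<inter> V\<close> at most once.\<close>
  have row: "(\<Sum>w\<in>Y. q x w) \<le> 1" if "finite Y" for x Y
  proof -
    have f: "finite (E R `` {x})" by (simp add: finite_Image_E)
    have "(\<Sum>w\<in>Y. q x w) = (\<Sum>w\<in>Y \<inter> E R `` {x}. q x w)"
      using that q(2) by (intro sum.mono_neutral_right) auto
    also have "\<dots> \<le> (\<Sum>w\<in>E R `` {x}. q x w)" using f q(1) by (intro sum_mono2) auto
    finally show ?thesis using q(3) by simp
  qed
  have "real (card (core (2 * R) J)) \<le> (\<Sum>w\<in>J0. \<Sum>x\<in>J. q x w)"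
  proof -
    have "real (card (core (2 * R) J)) = (\<Sum>x\<in>core (2 * R) J. 1)" by simp
    also have "\<dots> \<le> (\<Sum>x\<in>core (2 * R) J. \<Sum>w\<in>J0. q x w)"
    proof (rule sum_mono)
      fix x assume x: "x \<in> core (2 * R) J"
      have "E R `` {x} \<subseteq> J0"
      proof
        fix w assume w: "w \<in> E R `` {x}"
        have "E R `` {w} \<subseteq> E (2 * R) `` {x}" using w E_trans[of x w R] by (auto simp: mult_2)
        then have "E R `` {w} \<subseteq> J" using x unfolding core_def by auto
        moreover have "w \<in> J" using calculation E_refl by auto
        ultimately show "w \<in> J0" unfolding J0_def core_def by auto
      qed
      then have "(\<Sum>y\<in>E R `` {x}. q x y) \<le> (\<Sum>w\<in>J0. q x w)" using J0 q(1) by (intro sum_mono2) auto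
      then show "1 \<le> (\<Sum>w\<in>J0. q x w)" using q(3) by simp
    qed
    also have "\<dots> \<le> (\<Sum>x\<in>J. \<Sum>w\<in>J0. q x w)"
      using J q(1) by (intro sum_mono2 sum_nonneg) (auto simp: core_def)
    also have "\<dots> = (\<Sum>w\<in>J0. \<Sum>x\<in>J. q x w)" by (rule sum.swap)
    finally show ?thesis .
  qed
  then have 1: "\<epsilon> * card (core (2 * R) J) \<le> \<epsilon> * (\<Sum>w\<in>J0. \<Sum>x\<in>J. q x w)" using pos by (intro mult_left_mono)
  have "(\<Sum>w\<in>J0. \<Sum>x\<in>J. \<Sum>z\<in>G `` {x}. \<bar>q x w - q z w\<bar>) = (\<Sum>x\<in>J. \<Sum>w\<in>J0. \<Sum>z\<in>G `` {x}. \<bar>q x w - q z w\<bar>)"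
    by (rule sum.swap)
  also have "\<dots> = (\<Sum>x\<in>J. \<Sum>z\<in>G `` {x}. \<Sum>w\<in>J0. \<bar>q x w - q z w\<bar>)"
    by (intro sum.cong refl sum.swap)
  also have "\<dots> \<le> (\<Sum>x\<in>J. \<Sum>z\<in>G `` {x}. \<eta>)"
    using J0 by (intro sum_mono var) auto
  also have "\<dots> \<le> (\<Sum>x\<in>J. D * \<eta>)"
    using degree pos by (intro sum_mono) (auto intro!: mult_right_mono)
  finally have "(\<Sum>w\<in>J0. \<Sum>x\<in>J. \<Sum>z\<in>G `` {x}. \<bar>q x w - q z w\<bar>) \<le> D * \<eta> * card J" by (simp add: algebra_simps)
  then have 2: "\<epsilon> / \<delta> * (\<Sum>w\<in>J0. \<Sum>x\<in>J. \<Sum>z\<in>G `` {x}. \<bar>q x w - q z w\<bar>) \<le> \<epsilon> / \<delta> * (D * \<eta> * card J)"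
    using pos by (intro mult_left_mono) auto
  have "(\<Sum>w\<in>J0. \<Sum>x\<in>J. q x w * indicator V x) = (\<Sum>x\<in>J. (\<Sum>w\<in>J0. q x w) * indicator V x)"
    by (subst sum.swap) (simp add: sum_distrib_right)
  also have "\<dots> \<le> (\<Sum>x\<in>J. indicator V x)"
    using row[OF J0] by (intro sum_mono) (auto simp: indicator_def)
  also have "\<dots> = card (J \<inter> V)" using J by (simp add: sum_indicator_card)
  finally show ?thesis using total 1 2 by linarith
qed

end

section \<open>From uniform amenability to finite kernels and covering constants\<close>

text \<open>Extending \<open>p\<close> by zero outside the component relation and using its bounded
  range turns the infinite sums into finite ones, valid for arbitrary finite
  \<open>Y\<close>.\<close>

lemma amenable_kernel:
  fixes G :: "('a::polish_space \<times> 'a) set"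
  assumes "bounded_graph G D" and "unif_borel_amenable G" and n: "n \<ge> 1"
  obtains q :: "'a \<Rightarrow> 'a \<Rightarrow> real" and R where
    "\<And>x y. q x y \<ge> 0" "\<And>x y. (x, y) \<notin> bounded_graph.E G R \<Longrightarrow> q x y = 0"
    "\<And>x. (\<Sum>y\<in>bounded_graph.E G R `` {x}. q x y) = 1"
    "\<And>x z Y. (x, z) \<in> G \<Longrightarrow> finite Y \<Longrightarrow> (\<Sum>y\<in>Y. \<bar>q x y - q z y\<bar>) \<le> 1 / real n"
proof -
  interpret bounded_graph G D by fact
  from assms(2)[unfolded unif_borel_amenable_def, THEN conjunct2, rule_format, OF n]
  obtain p :: "'a \<times> 'a \<Rightarrow> real" and r where p: "\<forall>xy\<in>comp_rel G. p xy \<ge> 0"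
    "\<forall>x. (\<Sum>\<^sub>\<infinity>y\<in>comp_rel G `` {x}. p (x, y)) = 1"
    "\<forall>x z. (x, z) \<in> G \<longrightarrow> (\<Sum>\<^sub>\<infinity>y\<in>comp_rel G `` {x}. \<bar>p (x, y) - p (z, y)\<bar>) < 1 / real n"
    "\<forall>x y. (x, y) \<in> comp_rel G \<and> \<not> gdist_le G x y r \<longrightarrow> p (x, y) = 0"
    by (elim exE conjE) (rule that; assumption)
  define q where "q x y = (if (x, y) \<in> comp_rel G then p (x, y) else 0)" for x y
  define R where "R = nat \<lceil>r\<rceil>"
  have q0: "q x y = 0" if "(x, y) \<notin> E R" for x y
  proof -
    have "r \<le> real R" unfolding R_def by linarith
    then have "\<not> gdist_le G x y r" using gdist_le_E that by blast
    then show ?thesis using p(4) unfolding q_def by auto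
  qed
  have "(\<Sum>y\<in>E R `` {x}. q x y) = 1" for x
  proof -
    have "(\<Sum>\<^sub>\<infinity>y\<in>comp_rel G `` {x}. p (x, y)) = (\<Sum>\<^sub>\<infinity>y\<in>E R `` {x}. q x y)"
    proof (intro infsum_cong_neutral)
      fix y assume "y \<in> E R `` {x} - comp_rel G `` {x}"
      then show "q x y = 0" using E_comp_rel by auto
    next
      fix y assume "y \<in> comp_rel G `` {x} - E R `` {x}"
      then show "p (x, y) = 0" using q0[of x y] unfolding q_def by auto
    qed (auto simp: q_def)
    then show ?thesis using p(2) by (simp add: finite_Image_E)
  qed
  moreover have "(\<Sum>y\<in>Y. \<bar>q x y - q z y\<bar>) \<le> 1 / real n" if xz: "(x, z) \<in> G" and Y: "finite Y" for x z Y
  proof -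
    have comp: "(x, y) \<in> comp_rel G \<longleftrightarrow> (z, y) \<in> comp_rel G" for y
      using xz symD[OF sym_G xz] unfolding comp_rel_def by (meson converse_rtrancl_into_rtrancl)
    \<comment> \<open>Adjacent points x and z have R-balls inside the ball of radius
      \<open>Suc R\<close> around x, so both rows are supported there.\<close>
    let ?F = "E (Suc R) `` {x}"
    have F: "finite ?F" by (simp add: finite_Image_E)
    have z0: "\<bar>q x y - q z y\<bar> = 0" if "y \<notin> ?F" for y
    proof -
      have "(x, y) \<notin> E R" using that E_mono[of R "Suc R"] by auto
      moreover have "(z, y) \<notin> E R" using that E_trans[OF E_one[OF xz], of y R] by auto
      ultimately show ?thesis using q0 by simp
    qed
    have "(\<Sum>y\<in>Y. \<bar>q x y - q z y\<bar>) = (\<Sum>y\<in>Y \<inter> ?F. \<bar>q x y - q z y\<bar>)"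
      using Y z0 by (intro sum.mono_neutral_right) auto
    also have "\<dots> \<le> (\<Sum>y\<in>?F. \<bar>q x y - q z y\<bar>)" using F by (intro sum_mono2) auto
    also have "\<dots> = (\<Sum>\<^sub>\<infinity>y\<in>?F. \<bar>q x y - q z y\<bar>)" using F by simp
    also have "\<dots> = (\<Sum>\<^sub>\<infinity>y\<in>comp_rel G `` {x}. \<bar>p (x, y) - p (z, y)\<bar>)"
    proof (intro infsum_cong_neutral)
      fix y assume "y \<in> comp_rel G `` {x} - ?F"
      then show "\<bar>p (x, y) - p (z, y)\<bar> = 0" using z0[of y] comp unfolding q_def by auto
    next
      fix y assume "y \<in> ?F - comp_rel G `` {x}"
      then show "\<bar>q x y - q z y\<bar> = 0" using E_comp_rel by auto
    next
      fix y assume "y \<in> ?F \<inter> comp_rel G `` {x}"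
      then show "\<bar>q x y - q z y\<bar> = \<bar>p (x, y) - p (z, y)\<bar>" using comp unfolding q_def by auto
    qed
    also have "\<dots> < 1 / real n" using p(3) xz by blast
    finally show ?thesis by simp
  qed
  moreover have "q x y \<ge> 0" for x y using p(1) unfolding q_def by auto
  ultimately show ?thesis using q0 by (intro that)
qed

context borel_bounded_graph
begin

text \<open>The core keeps 3/4 of J and the variation costs at most a quarter, so a share
  \<open>3/4 * \<epsilon> - 1/4 * \<epsilon>\<close> is covered. The kernel is chosen before
  \<open>C\<close>, which makes \<open>R\<close> and \<rho> uniform in \<open>C\<close>.\<close>

lemma folner_family_covering:
  assumes am: "unif_borel_amenable G" and \<delta>: "\<delta> > 0" and \<epsilon>: "0 < \<epsilon>" "\<epsilon> \<le> 1"
  obtains R \<rho> where "\<rho> > 0" "\<And>C. C \<in> sets borel \<Longrightarrow> \<exists>V T. folner_family C R \<delta> \<epsilon> V T \<and>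
    (\<forall>J. finite J \<longrightarrow> J \<inter> C = {} \<longrightarrow> folner_set G \<rho> J \<longrightarrow> \<epsilon> / 2 * card J \<le> card (J \<inter> V))"
proof -
  \<comment> \<open>This bounds \<open>D / (\<delta> * n)\<close> by 1/4, the relative cost of the
    variation.\<close>
  obtain n :: nat where n: "n \<ge> 1" "4 * D / \<delta> \<le> n"
    by (metis linorder_linear max.bounded_iff of_nat_le_iff order_trans real_arch_simple)
  obtain q :: "'a \<Rightarrow> 'a \<Rightarrow> real" and R where q: "\<And>x y. q x y \<ge> 0" "\<And>x y. (x, y) \<notin> E R \<Longrightarrow> q x y = 0"
    "\<And>x. (\<Sum>y\<in>E R `` {x}. q x y) = 1"
    "\<And>x z Y. (x, z) \<in> G \<Longrightarrow> finite Y \<Longrightarrow> (\<Sum>y\<in>Y. \<bar>q x y - q z y\<bar>) \<le> 1 / real n"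
    using amenable_kernel[OF bounded_graph_axioms am n(1)] by blast
  define M where "M = real (Suc D ^ (2 * R))"
  have M: "M > 0" unfolding M_def by simp
  \<comment> \<open>\<open>M\<close> bounds the size of balls of radius \<open>2 * R\<close>, so at
    most \<open>card J / 4\<close> points lie outside the core.\<close>
  define \<rho> where "\<rho> = 1 / (4 * M)"
  show ?thesis
  proof (rule that)
    show "\<rho> > 0" unfolding \<rho>_def using M by simp
    fix C :: "'a set" assume "C \<in> sets borel"
    then obtain V T where VT: "folner_family C R \<delta> \<epsilon> V T"
      "\<And>S w. S \<subseteq> E R `` {w} \<Longrightarrow> S \<inter> C = {} \<Longrightarrow> folner_set G \<delta> S \<Longrightarrow> \<epsilon> * card S \<le> card (S \<inter> V)"
      using maximal_folner_family \<epsilon>(2) by metis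
    have "\<epsilon> / 2 * card J \<le> card (J \<inter> V)" if J: "finite J" "J \<inter> C = {}" "folner_set G \<rho> J" for J
    proof -
      have cJ: "card J > 0" using J unfolding folner_set_def by (simp add: card_gt_0_iff)
      have "real (card (gboundary G J)) \<le> \<rho> * card J"
        using J(3) cJ unfolding folner_set_def by (simp add: field_simps)
      then have "M * card (gboundary G J) \<le> M * (\<rho> * card J)" using M by (intro mult_left_mono) auto
      also have "\<dots> = card J / 4" using M unfolding \<rho>_def by simp
      finally have b: "M * card (gboundary G J) \<le> card J / 4" .
      have "card J \<le> card (core (2 * R) J) + card (J - core (2 * R) J)"
        using card_Un_le[of "core (2 * R) J" "J - core (2 * R) J"] by (simp add: core_def Un_Diff_cancel Un_absorb1 subset_iff)
      moreover have "real (card (J - core (2 * R) J)) \<le> M * card (gboundary G J)"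
        using card_Diff_core[OF J(1), of "2 * R"] unfolding M_def by (metis of_nat_le_iff of_nat_mult)
      ultimately have core: "3 / 4 * card J \<le> card (core (2 * R) J)" using b by linarith
      have "D / (\<delta> * n) \<le> 1 / 4" using n \<delta> by (simp add: field_simps)
      then have "\<epsilon> * card J * (D / (\<delta> * n)) \<le> \<epsilon> * card J * (1 / 4)" using \<epsilon> by (intro mult_left_mono) auto
      then have "\<epsilon> / \<delta> * (D * (1 / real n) * card J) \<le> \<epsilon> / 4 * card J" by (simp add: field_simps)
      moreover have "\<epsilon> * (3 / 4 * card J) \<le> \<epsilon> * card (core (2 * R) J)" using core \<epsilon> by (intro mult_left_mono) auto
      moreover have "\<epsilon> * card (core (2 * R) J) - \<epsilon> / \<delta> * (D * (1 / real n) * card J) \<le> card (J \<inter> V)"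
        using card_Int_ge_of_dense[of q R "1 / real n" C \<delta> \<epsilon> V J] q VT(2) J \<delta> \<epsilon> by simp
      ultimately show ?thesis by linarith
    qed
    with VT(1) show "\<exists>V T. folner_family C R \<delta> \<epsilon> V T \<and>
      (\<forall>J. finite J \<longrightarrow> J \<inter> C = {} \<longrightarrow> folner_set G \<rho> J \<longrightarrow> \<epsilon> / 2 * card J \<le> card (J \<inter> V))" by blast
  qed
qed

end

section \<open>Iteration over scales\<close>

lemma gdist_le_mono: "gdist_le G x y r \<Longrightarrow> r \<le> s \<Longrightarrow> gdist_le G x y s"
  unfolding gdist_le_def by (meson order_trans)

lemma folner_set_mono: "folner_set G \<epsilon> S \<Longrightarrow> \<epsilon> \<le> \<epsilon>' \<Longrightarrow> folner_set G \<epsilon>' S"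
  unfolding folner_set_def by auto

lemma folner_set_iff:
  "folner_set G \<epsilon> S \<longleftrightarrow> finite S \<and> S \<noteq> {} \<and> real (card (gboundary G S)) < \<epsilon> * card S"
proof (cases "finite S \<and> S \<noteq> {}")
  case True
  then have "0 < card S" by (simp add: card_gt_0_iff)
  then show ?thesis using True unfolding folner_set_def by (simp add: field_simps)
qed (auto simp: folner_set_def)

lemma folner_packing_mono:
  assumes "folner_packing G \<epsilon> k V T" "k \<le> k'" shows "folner_packing G \<epsilon> k' V T"
proof -
  have "folner_diam_set G \<epsilon> k' S" if "folner_diam_set G \<epsilon> k S" for S
    using that gdist_le_mono[OF _ assms(2)] unfolding folner_diam_set_def by metis
  then show ?thesis using assms(1) unfolding folner_packing_def by simp
qed

lemma folner_packing_Un: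
  assumes p1: "folner_packing G \<epsilon> k V T" and p2: "folner_packing G \<epsilon> k V' T'" and disj: "V \<inter> V' = {}"
  shows "folner_packing G \<epsilon> k (V \<union> V') (T \<union> T')"
proof -
  have b: "borel_packing G V T" "borel_packing G V' T'" using p1 p2 by (auto simp: folner_packing_def)
  then have eq: "equiv V T" "equiv V' T'" by (auto simp: borel_packing_def)
  note q = quotient_Un_disjoint[OF eq disj]
  have tl: "\<forall>S\<in>tiles (V \<union> V') (T \<union> T'). folner_diam_set G \<epsilon> k S"
    using p1 p2 unfolding folner_packing_def tiles_def q(2) by auto
  have "gdist_le G y z k" if "x \<in> V \<union> V'" "y \<in> (T \<union> T') `` {x}" "z \<in> (T \<union> T') `` {x}" for x y z
  proof -
    have "(T \<union> T') `` {x} \<in> tiles (V \<union> V') (T \<union> T')" unfolding tiles_def using that(1) by (rule quotientI)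
    then have "folner_diam_set G \<epsilon> k ((T \<union> T') `` {x})" using tl by simp
    then show ?thesis using that(2,3) unfolding folner_diam_set_def by simp
  qed
  then have "\<exists>B. \<forall>x\<in>V \<union> V'. \<forall>y\<in>(T \<union> T') `` {x}. \<forall>z\<in>(T \<union> T') `` {x}. gdist_le G y z B"
    by (intro exI[of _ k]) simp
  moreover have "T \<union> T' \<subseteq> comp_rel G" "V \<union> V' \<in> sets borel" "T \<union> T' \<in> sets (borel \<Otimes>\<^sub>M borel)"
    using b unfolding borel_packing_def by auto
  ultimately have "borel_packing G (V \<union> V') (T \<union> T')"
    unfolding borel_packing_def using q(1) by simp
  then show ?thesis using tl unfolding folner_packing_def by simp
qed

lemma packed_part_subset: "packed_part V T J \<subseteq> J"
  unfolding packed_part_def by auto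

lemma packed_part_Un:
  assumes "equiv V T" "equiv V' T'" "V \<inter> V' = {}" "J' \<subseteq> J"
  shows "packed_part V T J \<union> packed_part V' T' J' \<subseteq> packed_part (V \<union> V') (T \<union> T') J"
  using assms(4) unfolding packed_part_def tiles_def quotient_Un_disjoint(2)[OF assms(1-3)] by blast

lemma folner_packing_empty: "folner_packing G \<epsilon> k {} {}"
  unfolding folner_packing_def borel_packing_def tiles_def by (auto simp: equiv_def refl_on_def)

context borel_bounded_graph
begin

lemma E_diameter: "S \<subseteq> E R `` {w} \<Longrightarrow> x \<in> S \<Longrightarrow> y \<in> S \<Longrightarrow> (x, y) \<in> E (2 * R)"
  using E_trans[OF E_sym, of w x R y R] by (auto simp: mult_2)

lemma folner_familyE:
  assumes "folner_family C R \<delta> \<epsilon> V T" "t \<in> V // T"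
  obtains S w where "t \<subseteq> S" "S \<subseteq> V" "S \<subseteq> E R `` {w}" "folner_set G \<delta> S" "(1 - \<epsilon>) * card S \<le> card t"
proof -
  have "\<forall>t\<in>V // T. \<exists>S w. t \<subseteq> S \<and> S \<subseteq> V \<and> S \<subseteq> E R `` {w} \<and> folner_set G \<delta> S \<and> (1 - \<epsilon>) * card S \<le> card t"
    using assms(1) by (simp add: folner_family_def)
  from bspec[OF this assms(2)] show ?thesis by (elim exE conjE) (rule that)
qed

text \<open>A boundary point of t is a boundary point of \<open>S\<close> or a neighbour of one of
  the at most \<open>\<epsilon> * card S\<close> deleted points. This gives at most
  \<open>(\<delta> + D * \<epsilon>) * card S\<close>, hence \<open>\<gamma> / 4 * card S\<close>,
  and t has at least half the points of \<open>S\<close>.\<close>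

lemma folner_family_packing:
  fixes \<epsilon> \<delta> \<gamma> :: real
  assumes F: "folner_family C R \<delta> \<epsilon> V T" and \<epsilon>: "0 \<le> \<epsilon>" "\<epsilon> \<le> 1 / 2"
    and small: "D * \<epsilon> \<le> \<gamma> / 8" "\<delta> \<le> \<gamma> / 8" "\<gamma> > 0"
  shows "folner_packing G \<gamma> (real (2 * R)) V T"
proof -
  have VT: "V \<in> sets borel" "T \<in> sets (borel \<Otimes>\<^sub>M borel)" "equiv V T"
    using F by (auto simp: folner_family_def)
  have tl: "folner_diam_set G \<gamma> (real (2 * R)) t \<and> (\<forall>x\<in>t. \<forall>y\<in>t. (x, y) \<in> E (2 * R))" if t: "t \<in> V // T" for t
  proof -
    obtain S w where S: "t \<subseteq> S" "S \<subseteq> E R `` {w}" "folner_set G \<delta> S" "(1 - \<epsilon>) * card S \<le> card t"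
      by (rule folner_familyE[OF F t])
    have fS: "finite S" "finite t" using finite_ball[OF S(2)] finite_subset[OF S(1)] by auto
    have dS: "card (gboundary G S) < \<delta> * card S" and cS: "card S > 0"
      using S(3) by (auto simp: folner_set_iff card_gt_0_iff)
    have "gboundary G t \<subseteq> gboundary G S \<union> G `` (S - t)"
      using S(1) symD[OF sym_G] unfolding gboundary_def by blast
    moreover have fb: "finite (gboundary G S)" using fS unfolding gboundary_def by simp
    moreover have "finite (G `` (S - t))" using fS by (intro finite_Image_G) auto
    ultimately have "card (gboundary G t) \<le> card (gboundary G S \<union> G `` (S - t))" by (intro card_mono) auto
    also have "\<dots> \<le> card (gboundary G S) + card (G `` (S - t))" by (rule card_Un_le)
    also have "\<dots> \<le> card (gboundary G S) + D * card (S - t)" using fS by (intro add_left_mono finite_Image_G) auto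
    finally have "real (card (gboundary G t)) \<le> card (gboundary G S) + D * real (card (S - t))"
      by (metis of_nat_add of_nat_le_iff of_nat_mult)
    moreover have "real (card (S - t)) = real (card S) - real (card t)"
      using S(1) fS by (simp add: card_Diff_subset card_mono of_nat_diff)
    then have "D * real (card (S - t)) \<le> D * (\<epsilon> * card S)"
      using S(4) by (intro mult_left_mono) (auto simp: algebra_simps)
    moreover have "D * (\<epsilon> * card S) \<le> \<gamma> / 8 * card S"
      using mult_right_mono[OF small(1), of "real (card S)"] by (simp add: mult.assoc)
    moreover have "\<delta> * card S \<le> \<gamma> / 8 * card S"
      using mult_right_mono[OF small(2), of "real (card S)"] by simp
    ultimately have "card (gboundary G t) \<le> \<gamma> / 4 * card S" using dS by linarith
    moreover have "1 / 2 * card S \<le> (1 - \<epsilon>) * card S" using \<epsilon> by (intro mult_right_mono) auto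
    then have ct: "card S \<le> 2 * real (card t)" using S(4) by linarith
    then have "\<gamma> / 4 * card S \<le> \<gamma> / 4 * (2 * card t)" using small(3) by (intro mult_left_mono) auto
    moreover have "card t > 0" using ct cS by linarith
    then have "\<gamma> / 4 * (2 * card t) < \<gamma> * card t" using small(3) by simp
    ultimately have "card (gboundary G t) < \<gamma> * card t" by linarith
    then have "folner_set G \<gamma> t" using fS \<open>card t > 0\<close> by (auto simp: folner_set_iff)
    moreover have "\<forall>x\<in>t. \<forall>y\<in>t. (x, y) \<in> E (2 * R)" using E_diameter[OF S(2)] S(1) by blast
    moreover from this have "\<forall>x\<in>t. \<forall>y\<in>t. gdist_le G x y (real (2 * R))" using E_gdist_le by blast
    ultimately show ?thesis unfolding folner_diam_set_def by blast
  qed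
  have cls: "T `` {x} \<in> V // T" if "x \<in> V" for x using that by (rule quotientI)
  have "T \<subseteq> comp_rel G"
  proof
    fix p assume p: "p \<in> T"
    obtain x y where xy: "p = (x, y)" by (cases p)
    have "x \<in> V" using equiv_type[OF VT(3)] p xy by blast
    moreover from this have "x \<in> T `` {x}" using equiv_class_self[OF VT(3)] by blast
    ultimately have "(x, y) \<in> E (2 * R)" using tl[OF cls] p xy by blast
    then show "p \<in> comp_rel G" using E_comp_rel xy by blast
  qed
  moreover have "\<forall>x\<in>V. \<forall>y\<in>T `` {x}. \<forall>z\<in>T `` {x}. gdist_le G y z (real (2 * R))"
    using tl[OF cls] unfolding folner_diam_set_def by blast
  ultimately show ?thesis
    unfolding folner_packing_def borel_packing_def tiles_def using VT tl by blast
qed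

text \<open>Tiles have diameter at most \<open>2 * R\<close>, so a tile that meets J and sticks out
  of it meets J only near the outside. The extra 1 in the depth matches
  \<open>folner_family_boundary\<close>, whose error is the same set.\<close>

lemma folner_family_uncovered:
  assumes F: "folner_family C R \<delta> \<epsilon> V T" and J: "finite J"
  shows "card (J \<inter> V) \<le> card (packed_part V T J) + card (J - core (2 * R + 1) J)"
proof -
  have eq: "equiv V T" using F by (simp add: folner_family_def)
  have "J \<inter> V \<subseteq> packed_part V T J \<union> (J - core (2 * R + 1) J)"
  proof
    fix x assume x: "x \<in> J \<inter> V"
    let ?t = "T `` {x}"
    have t: "?t \<in> V // T" using x by (auto intro: quotientI)
    have xt: "x \<in> ?t" using equiv_class_self[OF eq] x by blast
    obtain S w where S: "?t \<subseteq> S" "S \<subseteq> E R `` {w}" by (rule folner_familyE[OF F t])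
    show "x \<in> packed_part V T J \<union> (J - core (2 * R + 1) J)"
    proof (cases "?t \<subseteq> J")
      case True then show ?thesis using t xt unfolding packed_part_def tiles_def by blast
    next
      case False
      then obtain y where y: "y \<in> ?t" "y \<notin> J" by blast
      have "(x, y) \<in> E (2 * R)" using E_diameter[OF S(2)] S(1) xt y(1) by blast
      then have "(x, y) \<in> E (2 * R + 1)" by (rule E_mono[rotated]) simp
      then show ?thesis using x y unfolding core_def by blast
    qed
  qed
  then have "card (J \<inter> V) \<le> card (packed_part V T J \<union> (J - core (2 * R + 1) J))"
    using J finite_subset[OF packed_part_subset J] by (intro card_mono) auto
  also have "\<dots> \<le> card (packed_part V T J) + card (J - core (2 * R + 1) J)" by (rule card_Un_le)
  finally show ?thesis .
qed

text \<open>Removing \<open>V\<close> creates boundary at x only through a neighbour y in some tile.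
  As x is outside \<open>V\<close>, it is outside the Folner set \<open>S\<close> of that tile, so y
  is a boundary point of \<open>S\<close>. If \<open>S\<close> leaves J, x is near the outside of J;
  otherwise the boundary of \<open>S\<close> is charged to the tile, and tiles are disjoint.\<close>

lemma folner_family_boundary:
  fixes \<epsilon> \<delta> :: real
  assumes F: "folner_family C R \<delta> \<epsilon> V T" and J: "finite J" and \<epsilon>: "\<epsilon> \<le> 1 / 2" and \<delta>: "0 \<le> \<delta>"
  shows "real (card (gboundary G (J - V))) \<le> 2 * D * \<delta> * card J + card (J - core (2 * R + 1) J)"
proof -
  have eq: "equiv V T" using F by (simp add: folner_family_def)
  have "\<forall>t\<in>V // T. \<exists>S. t \<subseteq> S \<and> S \<subseteq> V \<and> (\<exists>w. S \<subseteq> E R `` {w}) \<and> folner_set G \<delta> S \<and> (1 - \<epsilon>) * card S \<le> card t"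
  proof
    fix t assume "t \<in> V // T"
    from folner_familyE[OF F this] obtain S w where "t \<subseteq> S" "S \<subseteq> V" "S \<subseteq> E R `` {w}" "folner_set G \<delta> S" "(1 - \<epsilon>) * card S \<le> card t" .
    then show "\<exists>S. t \<subseteq> S \<and> S \<subseteq> V \<and> (\<exists>w. S \<subseteq> E R `` {w}) \<and> folner_set G \<delta> S \<and> (1 - \<epsilon>) * card S \<le> card t"
      by (intro exI[of _ S] conjI exI[of _ w])
  qed
  from bchoice[OF this] obtain S where "\<forall>t\<in>V // T. t \<subseteq> S t \<and> S t \<subseteq> V \<and> (\<exists>w. S t \<subseteq> E R `` {w}) \<and>
    folner_set G \<delta> (S t) \<and> (1 - \<epsilon>) * card (S t) \<le> card t" ..
  then have S: "t \<subseteq> S t" "S t \<subseteq> V" "\<exists>w. S t \<subseteq> E R `` {w}" "folner_set G \<delta> (S t)" "(1 - \<epsilon>) * card (S t) \<le> card t"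
    if "t \<in> V // T" for t using that by simp_all
  \<comment> \<open>Only tiles whose entire \<open>S\<close> lies in J are charged; their union lies
    in J, which bounds the total charge by \<open>2 * \<delta> * card J\<close>.\<close>
  define P where "P = {t \<in> V // T. S t \<subseteq> J}"
  have PJ: "\<Union>P \<subseteq> J" "P \<subseteq> Pow J" using S(1) unfolding P_def by blast+
  then have fP: "finite P" using J finite_subset[OF PJ(2)] by simp
  have fb: "finite (gboundary G (S t))" if "t \<in> P" for t
    using that S(4) unfolding P_def folner_set_def gboundary_def by auto
  have sub: "gboundary G (J - V) \<subseteq> (J - core (2 * R + 1) J) \<union> G `` (\<Union>t\<in>P. gboundary G (S t))"
  proof
    fix x assume "x \<in> gboundary G (J - V)"
    then obtain y where x: "x \<in> J" "x \<notin> V" "(x, y) \<in> G" "y \<notin> J - V" unfolding gboundary_def by blast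
    have far: "x \<in> J - core (2 * R + 1) J" if "(y, v) \<in> E (2 * R)" "v \<notin> J" for v
    proof -
      have "(x, v) \<in> E (1 + 2 * R)" by (rule E_trans[OF E_one[OF x(3)] that(1)])
      then show ?thesis using that(2) x(1) unfolding core_def by (auto simp: add.commute)
    qed
    show "x \<in> (J - core (2 * R + 1) J) \<union> G `` (\<Union>t\<in>P. gboundary G (S t))"
    proof (cases "y \<in> J")
      case False then show ?thesis using far[OF E_refl] by blast
    next
      case True
      then have yV: "y \<in> V" using x(4) by blast
      let ?t = "T `` {y}"
      have t: "?t \<in> V // T" using yV by (rule quotientI)
      have "y \<in> ?t" using equiv_class_self[OF eq yV] .
      then have yS: "y \<in> S ?t" using S(1)[OF t] by blast
      show ?thesis
      proof (cases "S ?t \<subseteq> J")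
        case True
        have "(y, x) \<in> G" using x(3) symD[OF sym_G] by blast
        moreover from this have "y \<in> gboundary G (S ?t)" using yS S(2)[OF t] x(2) unfolding gboundary_def by blast
        ultimately show ?thesis using True t unfolding P_def by blast
      next
        case False
        then obtain v where v: "v \<in> S ?t" "v \<notin> J" by blast
        obtain w where "S ?t \<subseteq> E R `` {w}" using S(3)[OF t] by blast
        then have "(y, v) \<in> E (2 * R)" using yS v(1) by (rule E_diameter)
        then show ?thesis using far v(2) by blast
      qed
    qed
  qed
  have fU: "finite (\<Union>t\<in>P. gboundary G (S t))" using fP fb by blast
  have "card (gboundary G (J - V)) \<le> card ((J - core (2 * R + 1) J) \<union> G `` (\<Union>t\<in>P. gboundary G (S t)))"
    using sub J finite_Image_G(1)[OF fU] by (intro card_mono) auto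
  also have "\<dots> \<le> card (J - core (2 * R + 1) J) + card (G `` (\<Union>t\<in>P. gboundary G (S t)))" by (rule card_Un_le)
  also have "\<dots> \<le> card (J - core (2 * R + 1) J) + D * card (\<Union>t\<in>P. gboundary G (S t))"
    using finite_Image_G(2)[OF fU] by simp
  also have "\<dots> \<le> card (J - core (2 * R + 1) J) + D * (\<Sum>t\<in>P. card (gboundary G (S t)))"
    using card_UN_le[OF fP] by (intro add_left_mono mult_left_mono) auto
  finally have 1: "real (card (gboundary G (J - V))) \<le> card (J - core (2 * R + 1) J) + D * (\<Sum>t\<in>P. real (card (gboundary G (S t))))"
    by (metis of_nat_add of_nat_le_iff of_nat_mult of_nat_sum)
  have "(\<Sum>t\<in>P. real (card (gboundary G (S t)))) \<le> (\<Sum>t\<in>P. 2 * \<delta> * card t)"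
  proof (rule sum_mono)
    fix t assume "t \<in> P"
    then have t: "t \<in> V // T" unfolding P_def by blast
    have "1 / 2 * card (S t) \<le> (1 - \<epsilon>) * card (S t)" using \<epsilon> by (intro mult_right_mono) auto
    then have "card (S t) \<le> 2 * real (card t)" using S(5)[OF t] by linarith
    then have "\<delta> * card (S t) \<le> \<delta> * (2 * real (card t))" using \<delta> by (intro mult_left_mono) auto
    moreover have "card (gboundary G (S t)) < \<delta> * card (S t)" using S(4)[OF t] by (simp add: folner_set_iff)
    ultimately show "real (card (gboundary G (S t))) \<le> 2 * \<delta> * card t" by simp
  qed
  also have "\<dots> = 2 * \<delta> * (\<Sum>t\<in>P. card t)" by (simp add: sum_distrib_left)
  also have "(\<Sum>t\<in>P. card t) = card (\<Union>P)"
  proof (rule card_Union_disjoint[symmetric])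
    show "pairwise disjnt P"
      using quotient_disj[OF eq] unfolding pairwise_def disjnt_def P_def by blast
    show "\<And>A. A \<in> P \<Longrightarrow> finite A" using PJ(2) J finite_subset by blast
  qed
  also have "2 * \<delta> * card (\<Union>P) \<le> 2 * \<delta> * card J"
    using card_mono[OF J PJ(1)] \<delta> by (intro mult_left_mono) auto
  finally have "(\<Sum>t\<in>P. real (card (gboundary G (S t)))) \<le> 2 * \<delta> * card J" .
  then have "D * (\<Sum>t\<in>P. real (card (gboundary G (S t)))) \<le> D * (2 * \<delta> * card J)" by (intro mult_left_mono) auto
  then show ?thesis using 1 by (simp add: algebra_simps)
qed

text \<open>The packing has to avoid a prescribed set C, with constants independent of C: this is what lets
  the tiles of smaller scales be placed after those of larger scales.\<close>

definition packs :: "real \<Rightarrow> real \<Rightarrow> bool" where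
  "packs \<gamma> a \<longleftrightarrow> (\<exists>k \<rho>. \<rho> > 0 \<and> (\<forall>C\<in>sets borel. \<exists>V T. V \<inter> C = {} \<and> folner_packing G \<gamma> k V T \<and>
     (\<forall>J. finite J \<longrightarrow> J \<inter> C = {} \<longrightarrow> folner_set G \<rho> J \<longrightarrow> (1 - a) * card J \<le> card (packed_part V T J))))"

text \<open>The new stage avoids \<open>C\<close>, then the given scheme is applied off
  \<open>C \<union> V1\<close> to what is left of J. The stage covers a share
  \<open>\<epsilon> / 2\<close>, reducing the uncovered share to
  \<open>a * (1 - \<epsilon> / 2)\<close>; tiles sticking out of J cost
  \<open>a * \<epsilon> / 4\<close> of it back.\<close>

lemma packs_step:
  fixes \<epsilon> \<gamma> a :: real
  assumes am: "unif_borel_amenable G" and \<epsilon>: "0 < \<epsilon>" "\<epsilon> \<le> 1 / 2" "D * \<epsilon> \<le> \<gamma> / 8" and \<gamma>: "\<gamma> > 0"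
    and a: "0 < a" and pa: "packs \<gamma> a"
  shows "packs \<gamma> (a * (1 - \<epsilon> / 4))"
proof -
  from pa[unfolded packs_def]
  obtain k \<rho>' where \<rho>': "\<rho>' > 0" and IH: "\<forall>C\<in>sets borel. \<exists>V T. V \<inter> C = {} \<and> folner_packing G \<gamma> k V T \<and>
     (\<forall>J. finite J \<longrightarrow> J \<inter> C = {} \<longrightarrow> folner_set G \<rho>' J \<longrightarrow> (1 - a) * card J \<le> card (packed_part V T J))"
    by (elim exE conjE)
  \<comment> \<open>The first bound makes the tiles \<gamma>-Folner. The second keeps
    \<open>J - V1\<close> Folner for the later tolerance \<rho>' as long as it has at least
    \<open>a / 2 * card J\<close> points.\<close>
  define \<delta> where "\<delta> = min (\<gamma> / 8) (a * \<rho>' / (16 * real (Suc D)))"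
  have \<delta>: "\<delta> > 0" "\<delta> \<le> \<gamma> / 8"
    using \<gamma> a \<rho>' min.cobounded1[of "\<gamma> / 8"] unfolding \<delta>_def by auto
  have D\<delta>: "2 * D * \<delta> \<le> a * \<rho>' / 8"
  proof -
    have "2 * D * \<delta> \<le> 2 * real (Suc D) * \<delta>" using \<delta> by (intro mult_right_mono) auto
    also have "\<dots> \<le> 2 * real (Suc D) * (a * \<rho>' / (16 * real (Suc D)))" by (intro mult_left_mono) (auto simp: \<delta>_def)
    also have "\<dots> = a * \<rho>' / 8" by (simp add: field_simps del: of_nat_Suc)
    finally show ?thesis .
  qed
  have "\<epsilon> \<le> 1" using \<epsilon> by simp
  obtain R \<rho>1 where \<rho>1: "\<rho>1 > 0" and cov: "\<forall>C\<in>sets borel. \<exists>V T. folner_family C R \<delta> \<epsilon> V T \<and>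
    (\<forall>J. finite J \<longrightarrow> J \<inter> C = {} \<longrightarrow> folner_set G \<rho>1 J \<longrightarrow> \<epsilon> / 2 * card J \<le> card (J \<inter> V))"
    using folner_family_covering[OF am \<delta>(1) \<epsilon>(1) \<open>\<epsilon> \<le> 1\<close>] by metis
  define M where "M = real (Suc D ^ (2 * R + 1))"
  have M: "M > 0" unfolding M_def of_nat_0_less_iff by simp
  \<comment> \<open>The points of J near its outside are used twice: as boundary of the rest (bound
    with \<rho>') and as loss from incomplete tiles (bound with \<epsilon>).\<close>
  define \<rho> where "\<rho> = min \<rho>1 (min (a * \<rho>' / (8 * M)) (a * \<epsilon> / (4 * M)))"
  have \<rho>: "\<rho> > 0" "\<rho> \<le> \<rho>1" unfolding \<rho>_def using \<rho>1 a \<rho>' M \<epsilon> by auto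
  have "\<rho> \<le> a * \<rho>' / (8 * M)" "\<rho> \<le> a * \<epsilon> / (4 * M)"
    by (simp_all add: \<rho>_def min_le_iff_disj)
  then have M\<rho>: "M * \<rho> \<le> a * \<rho>' / 8" "M * \<rho> \<le> a * \<epsilon> / 4"
    using M by (simp_all add: field_simps)
  define K where "K = max k (real (2 * R))"
  show ?thesis unfolding packs_def
  proof (rule exI[of _ K], rule exI[of _ \<rho>], intro conjI \<rho>(1) ballI)
    fix C :: "'a set" assume C: "C \<in> sets borel"
    from bspec[OF cov C]
    obtain V1 T1 where F: "folner_family C R \<delta> \<epsilon> V1 T1"
      and c1: "\<And>J. finite J \<Longrightarrow> J \<inter> C = {} \<Longrightarrow> folner_set G \<rho>1 J \<Longrightarrow> \<epsilon> / 2 * card J \<le> card (J \<inter> V1)"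
      by (elim exE conjE) (rule that, assumption, simp)
    have V1: "V1 \<in> sets borel" "V1 \<inter> C = {}" "equiv V1 T1" using F by (auto simp: folner_family_def)
    have "C \<union> V1 \<in> sets borel" using C V1 by simp
    then obtain V2 T2 where V2: "V2 \<inter> (C \<union> V1) = {}" "folner_packing G \<gamma> k V2 T2"
      and c2: "\<And>J. finite J \<Longrightarrow> J \<inter> (C \<union> V1) = {} \<Longrightarrow> folner_set G \<rho>' J \<Longrightarrow> (1 - a) * card J \<le> card (packed_part V2 T2 J)"
      using IH[rule_format, of "C \<union> V1"] by metis
    have eq2: "equiv V2 T2" using V2(2) by (auto simp: folner_packing_def borel_packing_def)
    have disj: "V1 \<inter> V2 = {}" using V2(1) by blast
    have p1: "folner_packing G \<gamma> (real (2 * R)) V1 T1"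
      using folner_family_packing[OF F _ \<epsilon>(2,3) \<delta>(2) \<gamma>] \<epsilon>(1) by simp
    have "folner_packing G \<gamma> K (V1 \<union> V2) (T1 \<union> T2)"
      by (rule folner_packing_Un[OF folner_packing_mono[OF p1] folner_packing_mono[OF V2(2)] disj]) (auto simp: K_def)
    moreover have "(V1 \<union> V2) \<inter> C = {}" using V1 V2 by blast
    moreover have "(1 - a * (1 - \<epsilon> / 4)) * card J \<le> card (packed_part (V1 \<union> V2) (T1 \<union> T2) J)"
      if J: "finite J" "J \<inter> C = {}" "folner_set G \<rho> J" for J
    proof -
      define j where "j = real (card J)"
      have j: "j > 0" using J unfolding folner_set_def j_def by (simp add: card_gt_0_iff)
      define J' where "J' = J - V1"
      define v where "v = real (card (J \<inter> V1))"
      have v: "\<epsilon> / 2 * j \<le> v" using c1[OF J(1,2) folner_set_mono[OF J(3) \<rho>(2)]] unfolding j_def v_def .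
      have cJ': "real (card J') = j - v"
        unfolding J'_def j_def v_def using J(1) by (simp add: card_Diff_subset_Int card_mono of_nat_diff)
      have "real (card (J - core (2 * R + 1) J)) \<le> M * card (gboundary G J)"
        using card_Diff_core[OF J(1), of "2 * R + 1"] unfolding M_def by (metis of_nat_le_iff of_nat_mult)
      also have "\<dots> \<le> M * (\<rho> * j)"
        using J(3) M unfolding j_def by (intro mult_left_mono) (auto simp: folner_set_iff)
      finally have core: "real (card (J - core (2 * R + 1) J)) \<le> M * \<rho> * j" by (simp add: mult.assoc)
      then have core1: "real (card (J - core (2 * R + 1) J)) \<le> a * \<epsilon> / 4 * j"
        and core2: "real (card (J - core (2 * R + 1) J)) \<le> a * \<rho>' / 8 * j"
        using mult_right_mono[OF M\<rho>(1), of j] mult_right_mono[OF M\<rho>(2), of j] j by linarith+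
      have q1: "v - a * \<epsilon> / 4 * j \<le> card (packed_part V1 T1 J)"
        using folner_family_uncovered[OF F J(1)] core1 unfolding v_def by linarith
      have sub: "packed_part V1 T1 J \<union> packed_part V2 T2 J' \<subseteq> packed_part (V1 \<union> V2) (T1 \<union> T2) J"
        by (rule packed_part_Un[OF V1(3) eq2 disj]) (auto simp: J'_def)
      have fp: "finite (packed_part V1 T1 J)" "finite (packed_part V2 T2 J')" "finite (packed_part (V1 \<union> V2) (T1 \<union> T2) J)"
        using J(1) by (auto simp: J'_def intro!: finite_subset[OF packed_part_subset])
      have "packed_part V1 T1 J \<inter> packed_part V2 T2 J' = {}"
      proof -
        have "packed_part V1 T1 J \<subseteq> V1"
          unfolding packed_part_def tiles_def using Union_quotient[OF V1(3)] by blast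
        then show ?thesis using packed_part_subset[of V2 T2 J'] unfolding J'_def by blast
      qed
      then have "card (packed_part V1 T1 J) + card (packed_part V2 T2 J') \<le> card (packed_part (V1 \<union> V2) (T1 \<union> T2) J)"
        using card_mono[OF fp(3) sub] fp by (simp add: card_Un_disjoint)
      then have tot: "real (card (packed_part V1 T1 J)) + card (packed_part V2 T2 J') \<le> card (packed_part (V1 \<union> V2) (T1 \<union> T2) J)"
        by linarith
      show ?thesis
      proof (cases "a / 2 * j \<le> card J'")
        case True
        have pos: "0 < real (card J')" using True a j by (smt (verit) divide_pos_pos mult_pos_pos)
        have "card (gboundary G J') \<le> 2 * D * \<delta> * j + a * \<rho>' / 8 * j"
          using folner_family_boundary[OF F J(1) \<epsilon>(2)] \<delta>(1) core2 unfolding J'_def j_def by simp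
        also have "\<dots> \<le> a * \<rho>' / 8 * j + a * \<rho>' / 8 * j" using mult_right_mono[OF D\<delta> less_imp_le[OF j]] by linarith
        also have "\<dots> = \<rho>' / 2 * (a / 2 * j)" by (simp add: field_simps)
        also have "\<dots> \<le> \<rho>' / 2 * card J'" using True \<rho>' by (intro mult_left_mono) auto
        also have "\<dots> < \<rho>' * card J'" using \<rho>' pos by simp
        finally have "folner_set G \<rho>' J'"
          using pos unfolding folner_set_iff by (simp add: card_gt_0_iff)
        then have "(1 - a) * (j - v) \<le> card (packed_part V2 T2 J')"
          using c2[of J'] J V2 unfolding cJ'[symmetric] J'_def by blast
        moreover have "a * (\<epsilon> / 2 * j) \<le> a * v" using v a by (intro mult_left_mono) auto
        ultimately show ?thesis using q1 tot unfolding j_def[symmetric] by (simp add: algebra_simps)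
      next
        \<comment> \<open>The new stage alone covers more than \<open>1 - a / 2\<close> of J, so
          nothing is asked of the later stages.\<close>
        case False
        then have "j - v < a / 2 * j" using cJ' by simp
        moreover have "a * j * \<epsilon> \<le> a * j * 1" using a j \<epsilon> by (intro mult_left_mono) auto
        moreover have "real (card (packed_part V2 T2 J')) \<ge> 0" by simp
        ultimately show ?thesis using q1 tot unfolding j_def[symmetric] by (simp add: algebra_simps)
      qed
    qed
    ultimately show "\<exists>V T. V \<inter> C = {} \<and> folner_packing G \<gamma> K V T \<and>
      (\<forall>J. finite J \<longrightarrow> J \<inter> C = {} \<longrightarrow> folner_set G \<rho> J \<longrightarrow> (1 - a * (1 - \<epsilon> / 4)) * card J \<le> card (packed_part V T J))"
      by blast
  qed
qed

text \<open>The overlap \<epsilon> is fixed by \<gamma> and \<open>D\<close>, so every step shrinks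
  the uncovered share by the same factor \<open>1 - \<epsilon> / 4\<close>, and finitely many steps
  bring it below \<gamma>.\<close>

lemma packs_arbitrary:
  assumes am: "unif_borel_amenable G" and \<gamma>: "\<gamma> > 0"
  shows "\<exists>a\<le>\<gamma>. packs \<gamma> a"
proof -
  define \<epsilon> where "\<epsilon> = min (1 / 2) (\<gamma> / (8 * real (Suc D)))"
  have \<epsilon>: "0 < \<epsilon>" "\<epsilon> \<le> 1 / 2" using \<gamma> min.cobounded1[of "1 / 2" "\<gamma> / (8 * real (Suc D))"] unfolding \<epsilon>_def by auto
  have "D * \<epsilon> \<le> Suc D * \<epsilon>" using \<epsilon> by (intro mult_right_mono) auto
  also have "\<dots> \<le> Suc D * (\<gamma> / (8 * real (Suc D)))" by (intro mult_left_mono) (auto simp: \<epsilon>_def)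
  also have "\<dots> = \<gamma> / 8" by (simp add: field_simps del: of_nat_Suc)
  finally have D\<epsilon>: "D * \<epsilon> \<le> \<gamma> / 8" .
  have "packs \<gamma> ((1 - \<epsilon> / 4) ^ m)" for m
  proof (induction m)
    \<comment> \<open>With uncovered share 1 the empty packing works, as the required covered size
      is 0.\<close>
    case 0
    have "\<exists>V T. V \<inter> C = {} \<and> folner_packing G \<gamma> 0 V T \<and> (\<forall>J. finite J \<longrightarrow> J \<inter> C = {} \<longrightarrow> folner_set G 1 J \<longrightarrow>
       (1 - 1) * real (card J) \<le> real (card (packed_part V T J)))" for C
      using folner_packing_empty[of G \<gamma> 0] by (intro exI[of _ "{}"]) auto
    then show ?case unfolding packs_def by (intro exI[of _ 0] exI[of _ 1]) auto
  next
    case (Suc m)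
    have "packs \<gamma> ((1 - \<epsilon> / 4) ^ m * (1 - \<epsilon> / 4))"
      using \<epsilon> by (intro packs_step[OF am \<epsilon> D\<epsilon> \<gamma> _ Suc]) auto
    then show ?case by (simp add: mult.commute)
  qed
  moreover obtain m where "(1 - \<epsilon> / 4) ^ m < \<gamma>" using real_arch_pow_inv[OF \<gamma>, of "1 - \<epsilon> / 4"] \<epsilon> by auto
  ultimately show ?thesis by (meson less_imp_le)
qed

end

theorem theorem3:
  fixes G :: "('a::polish_space \<times> 'a) set"
  assumes "borel_graph G" and "unif_borel_amenable G" and "folner_graph G"
  shows "\<forall>\<epsilon>0>0. \<exists>k>0. \<exists>\<rho>>0. \<exists>X' T. folner_packing G \<epsilon>0 k X' T \<and>
           (\<forall>J. finite J \<and> folner_set G \<rho> J \<longrightarrow>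
              real (card (packed_part X' T J)) / real (card J) \<ge> 1 - \<epsilon>0)"
proof (intro allI impI)
  fix \<epsilon>0 :: real assume "\<epsilon>0 > 0"
  obtain D where D: "\<And>x. finite (G `` {x}) \<and> card (G `` {x}) \<le> D"
    using assms(2) unfolding unif_borel_amenable_def bounded_degree_def by auto
  have G: "sym G" "G \<in> sets (borel \<Otimes>\<^sub>M borel)" using assms(1) by (auto simp: borel_graph_def)
  interpret borel_bounded_graph G D
    by unfold_locales (use G D borel_Image[OF G D] in auto)
  obtain a where a: "a \<le> \<epsilon>0" "packs \<epsilon>0 a" using packs_arbitrary[OF assms(2) \<open>\<epsilon>0 > 0\<close>] by blast
  from a(2)[unfolded packs_def] obtain k \<rho> where "\<rho> > 0" and
    *: "\<forall>C\<in>sets borel. \<exists>V T. V \<inter> C = {} \<and> folner_packing G \<epsilon>0 k V T \<and>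
     (\<forall>J. finite J \<longrightarrow> J \<inter> C = {} \<longrightarrow> folner_set G \<rho> J \<longrightarrow> (1 - a) * card J \<le> card (packed_part V T J))"
    by (elim exE conjE)
  from bspec[OF *, of "{}"] obtain V T where VT: "folner_packing G \<epsilon>0 k V T"
    "\<And>J. finite J \<Longrightarrow> folner_set G \<rho> J \<Longrightarrow> (1 - a) * card J \<le> card (packed_part V T J)"
    by auto
  \<comment> \<open>\<open>packs\<close> allows diameter bound 0, as for the empty packing, while a
    positive bound is required here.\<close>
  have "folner_packing G \<epsilon>0 (max k 1) V T" using VT(1) by (rule folner_packing_mono) simp
  moreover have "real (card (packed_part V T J)) / real (card J) \<ge> 1 - \<epsilon>0"
    if J: "finite J \<and> folner_set G \<rho> J" for J
  proof -
    have "card J > 0" using J by (auto simp: folner_set_def card_gt_0_iff)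
    have "(1 - \<epsilon>0) * card J \<le> (1 - a) * card J" using a by (intro mult_right_mono) auto
    also have "\<dots> \<le> card (packed_part V T J)" using VT(2) J by blast
    finally show ?thesis using \<open>card J > 0\<close> by (simp add: pos_le_divide_eq)
  qed
  moreover have "max k 1 > 0" by simp
  ultimately show "\<exists>k>0. \<exists>\<rho>>0. \<exists>X' T. folner_packing G \<epsilon>0 k X' T \<and>
           (\<forall>J. finite J \<and> folner_set G \<rho> J \<longrightarrow>
              real (card (packed_part X' T J)) / real (card J) \<ge> 1 - \<epsilon>0)"
    using \<open>\<rho> > 0\<close> by blast
qed

end
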